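(* For an indeterminate normalized Hamburger moment problem of order $\rho$ and type $\tau$, let $c_k=\big(\sum_{n=k}^\infty b_{k,n}^2\big)^{1/2}$, where $b_{k,n}$ is the coefficient of $x^k$ in the orthonormal polynomial $P_n$, and let $\Phi(z)=\sum_{k=0}^\infty c_kz^k$ (an entire function). Then the order and type of $\Phi$ are equal to the order $\rho$ and type $\tau$ of the moment problem (the statement about type being understood when $0<\rho<\infty$, so that type is defined).
   Context: A normalized Hamburger moment problem is given by a sequence $s_n=\int_{-\infty}^\infty x^n\,d\mu(x)$, $n\ge0$, where $\mu$ is a probability measure on $\mathbb R$ with infinite support and moments of every order. It is indeterminate if more than one measure $\mu$ has these moments. Let $P_n(x)=\sum_{k=0}^n b_{k,n}x^k$ be the orthonormal polynomials (positive leading coefficients) and $P(z)=(\sum_{n\ge0}|P_n(z)|^2)^{1/2}$; in the indeterminate case $P$ is finite and continuous on $\mathbb C$. It is known that in the indeterminate case the $c_k$ are finite and $\lim_k k\,c_k^{1/k}=0$, so $\Phi$ is entire. For an unbounded continuous $f:\mathbb C\to\mathbb C$ let $M_f(r)=\max_{|z|\le r}|f(z)|$. The order of $f$ is $\rho_f=\inf\{a>0\mid \log M_f(r)\le r^a\text{ for all sufficiently large }r\}$, and if $0<\rho_f<\infty$ the type is $\tau_f=\inf\{c>0\mid \log M_f(r)\le c\,r^{\rho_f}\text{ for all sufficiently large }r\}$. Let $Q_n$ be the polynomials of the second kind, $Q(z)=(\sum_n|Q_n(z)|^2)^{1/2}$, and let $A(z)=z\sum_k Q_k(0)Q_k(z)$,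 $B(z)=-1+z\sum_k Q_k(0)P_k(z)$, $C(z)=1+z\sum_k P_k(0)Q_k(z)$, $D(z)=z\sum_k P_k(0)P_k(z)$. It is known that for an indeterminate problem the six functions $A,B,C,D,P,Q$ have the same order and type; these common values are called the order $\rho$ and type $\tau$ of the moment problem. *)

theory Defs
  imports "HOL-Probability.Probability" "HOL-Computational_Algebra.Polynomial"
begin

definition max_modulus :: "(complex \<Rightarrow> complex) \<Rightarrow> real \<Rightarrow> real" where
  "max_modulus f r = (SUP z\<in>cball 0 r. norm (f z))"

text \<open>Order and type are extended reals, so that the infimum of the empty set is \<open>\<infinity>\<close>.\<close>

definition growth_order :: "(complex \<Rightarrow> complex) \<Rightarrow> ereal" where
  "growth_order f =
     Inf {ereal a | a. a > 0 \<and> (\<forall>\<^sub>F r in at_top. ln (max_modulus f r) \<le> r powr a)}"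

text \<open>Only meaningful if the order is positive and finite.\<close>

definition growth_type :: "(complex \<Rightarrow> complex) \<Rightarrow> ereal" where
  "growth_type f =
     Inf {ereal c | c. c > 0 \<and>
       (\<forall>\<^sub>F r in at_top. ln (max_modulus f r) \<le> c * r powr real_of_ereal (growth_order f))}"

definition has_moments :: "real measure \<Rightarrow> (nat \<Rightarrow> real) \<Rightarrow> bool" where
  "has_moments \<mu> s \<longleftrightarrow>
     sets \<mu> = sets borel \<and> (\<forall>n. has_bochner_integral \<mu> (\<lambda>x. x ^ n) (s n))"

definition measure_support :: "real measure \<Rightarrow> real set" where
  "measure_support \<mu> = {x. \<forall>U. open U \<and> x \<in> U \<longrightarrow> emeasure \<mu> U \<noteq> 0}"

definition indeterminate :: "(nat \<Rightarrow> real) \<Rightarrow> bool" where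
  "indeterminate s \<longleftrightarrow> (\<exists>\<mu> \<nu>. has_moments \<mu> s \<and> has_moments \<nu> s \<and> \<mu> \<noteq> \<nu>)"

definition orthonormal_polys :: "real measure \<Rightarrow> (nat \<Rightarrow> real poly) \<Rightarrow> bool" where
  "orthonormal_polys \<mu> p \<longleftrightarrow>
     (\<forall>n. degree (p n) = n \<and> lead_coeff (p n) > 0) \<and>
     (\<forall>m n. (\<integral>x. poly (p m) x * poly (p n) x \<partial>\<mu>) = of_bool (m = n))"

definition first_kind :: "(nat \<Rightarrow> real poly) \<Rightarrow> nat \<Rightarrow> complex \<Rightarrow> complex" where
  "first_kind p n z = poly (map_poly complex_of_real (p n)) z"

text \<open>
  The polynomials of the second kind, \<open>Q\<^sub>n(z) = \<integral> (P\<^sub>n(z) - P\<^sub>n(x)) / (z - x) d\<mu>(x)\<close>.  The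
  integrand is a polynomial in \<open>x\<close>; for real \<open>z\<close> its value at \<open>x = z\<close> has to be given
  separately, as \<open>\<mu>\<close> may have an atom there.
\<close>

definition second_kind ::
    "real measure \<Rightarrow> (nat \<Rightarrow> real poly) \<Rightarrow> nat \<Rightarrow> complex \<Rightarrow> complex" where
  "second_kind \<mu> p n z =
     (\<integral>x. (if complex_of_real x = z
            then poly (pderiv (map_poly complex_of_real (p n))) z
            else (first_kind p n z - first_kind p n (of_real x)) / (z - of_real x)) \<partial>\<mu>)"

definition fun_P :: "(nat \<Rightarrow> real poly) \<Rightarrow> complex \<Rightarrow> complex" where
  "fun_P p z = complex_of_real (sqrt (\<Sum>n. (norm (first_kind p n z))\<^sup>2))"

definition fun_Q :: "real measure \<Rightarrow> (nat \<Rightarrow> real poly) \<Rightarrow> complex \<Rightarrow> complex" where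
  "fun_Q \<mu> p z = complex_of_real (sqrt (\<Sum>n. (norm (second_kind \<mu> p n z))\<^sup>2))"

definition fun_A :: "real measure \<Rightarrow> (nat \<Rightarrow> real poly) \<Rightarrow> complex \<Rightarrow> complex" where
  "fun_A \<mu> p z = z * (\<Sum>k. second_kind \<mu> p k 0 * second_kind \<mu> p k z)"

definition fun_B :: "real measure \<Rightarrow> (nat \<Rightarrow> real poly) \<Rightarrow> complex \<Rightarrow> complex" where
  "fun_B \<mu> p z = - 1 + z * (\<Sum>k. second_kind \<mu> p k 0 * first_kind p k z)"

definition fun_C :: "real measure \<Rightarrow> (nat \<Rightarrow> real poly) \<Rightarrow> complex \<Rightarrow> complex" where
  "fun_C \<mu> p z = 1 + z * (\<Sum>k. first_kind p k 0 * second_kind \<mu> p k z)"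

definition fun_D :: "(nat \<Rightarrow> real poly) \<Rightarrow> complex \<Rightarrow> complex" where
  "fun_D p z = z * (\<Sum>k. first_kind p k 0 * first_kind p k z)"

definition moment_functions ::
    "real measure \<Rightarrow> (nat \<Rightarrow> real poly) \<Rightarrow> (complex \<Rightarrow> complex) set" where
  "moment_functions \<mu> p =
     {fun_A \<mu> p, fun_B \<mu> p, fun_C \<mu> p, fun_D p, fun_P p, fun_Q \<mu> p}"

text \<open>
  Order and type of an indeterminate problem are the common order and the common type of these
  six functions; the type is only meaningful if the order is positive and finite.
\<close>

definition moment_order :: "real measure \<Rightarrow> (nat \<Rightarrow> real poly) \<Rightarrow> ereal" where
  "moment_order \<mu> p = (THE \<rho>. \<forall>f\<in>moment_functions \<mu> p. growth_order f = \<rho>)"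

definition moment_type :: "real measure \<Rightarrow> (nat \<Rightarrow> real poly) \<Rightarrow> ereal" where
  "moment_type \<mu> p = (THE \<tau>. \<forall>f\<in>moment_functions \<mu> p. growth_type f = \<tau>)"

definition coeff_norm :: "(nat \<Rightarrow> real poly) \<Rightarrow> nat \<Rightarrow> real" where
  "coeff_norm p k = sqrt (\<Sum>n. (coeff (p (k + n)) k)\<^sup>2)"

definition Phi :: "(nat \<Rightarrow> real poly) \<Rightarrow> complex \<Rightarrow> complex" where
  "Phi p z = (\<Sum>k. complex_of_real (coeff_norm p k) * z ^ k)"

end

theory Submission
  imports Defs "HOL-Complex_Analysis.Complex_Analysis" "HOL-Real_Asymp.Real_Asymp"
begin

text \<open>
  Every comparison is between maximum moduli up to polynomial factors and a shift \<open>r \<mapsto> r + 1\<close>, which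
  affects neither order nor type.  Two distinct solutions of the moment problem have distinct Stieltjes
  transforms at some nonreal point, so Bessel's inequality for \<open>1 / (x - z)\<close> makes \<open>(P\<^sub>n(z))\<close> and
  \<open>(Q\<^sub>n(z))\<close> square summable there, and a discrete Gronwall argument extends this to all \<open>z\<close>, with
  \<open>ln P(z) = O(1 + |z|\<^sup>2)\<close>.  A Christoffel-Darboux identity gives \<open>|Im z| P(z)\<^sup>2 \<le> |B(z)| |D(z)|\<close>, and
  the maximum principle removes the factor \<open>|Im z|\<close>.  As \<open>|B|\<close> and \<open>|D|\<close> are bounded by a multiple of
  \<open>1 + |z| P(z)\<close>, this compares \<open>ln M\<^sub>P(r)\<close> with half of \<open>ln M\<^sub>P(r + 1)\<close> plus half of \<open>ln M\<^sub>B(r + 1)\<close> (or of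
  \<open>ln M\<^sub>D(r + 1)\<close>), which can be iterated; in the same way \<open>Q\<close> is compared with \<open>A\<close> and \<open>C\<close>.  Bessel's
  inequality also compares \<open>P\<close> with \<open>Q\<close>.  Finally \<open>P(z) \<le> \<Phi>(|z|)\<close> by Minkowski's inequality, while
  Cauchy's estimates give \<open>c\<^sub>k r\<^sup>k \<le> M\<^sub>P(r)\<close> and hence \<open>\<Phi>(r) \<le> (r + 1) M\<^sub>P(r + 1)\<close>.
\<close>

subsection \<open>Comparison of growth\<close>

text \<open>Order and type only compare \<open>ln (max_modulus f r)\<close> with multiples of
  powers, so the relation does the same. The slack \<open>c < c'\<close> absorbs constants,
  polynomial factors and shifts of \<open>r\<close>.\<close>

definition growth_dominated :: "(complex \<Rightarrow> complex) \<Rightarrow> (complex \<Rightarrow> complex) \<Rightarrow> bool" where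
  "growth_dominated f g \<longleftrightarrow> (\<forall>a>0. \<forall>c>0. \<forall>c'>c.
     (\<forall>\<^sub>F r in at_top. ln (max_modulus g r) \<le> c * r powr a) \<longrightarrow>
     (\<forall>\<^sub>F r in at_top. ln (max_modulus f r) \<le> c' * r powr a))"

lemma growth_dominatedD:
  assumes "growth_dominated f g" "0 < a" "0 < c" "c < c'"
    and "\<forall>\<^sub>F r in at_top. ln (max_modulus g r) \<le> c * r powr a"
  shows "\<forall>\<^sub>F r in at_top. ln (max_modulus f r) \<le> c' * r powr a"
  using assms unfolding growth_dominated_def by blast

lemma growth_dominated_trans:
  assumes "growth_dominated f g" "growth_dominated g h"
  shows "growth_dominated f h"
  unfolding growth_dominated_def
proof (intro allI impI)
  fix a c c' :: real
  assume *: "0 < a" "0 < c" "c < c'" "\<forall>\<^sub>F r in at_top. ln (max_modulus h r) \<le> c * r powr a"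
  have "\<forall>\<^sub>F r in at_top. ln (max_modulus g r) \<le> (c + c') / 2 * r powr a"
    by (rule growth_dominatedD[OF assms(2) *(1,2) _ *(4)]) (use * in simp)
  then show "\<forall>\<^sub>F r in at_top. ln (max_modulus f r) \<le> c' * r powr a"
    by (rule growth_dominatedD[OF assms(1) *(1), rotated 2]) (use * in auto)
qed

text \<open>The order is defined with constant 1, whereas domination enlarges the constant, here to
  2. The exponent is therefore raised by an arbitrary \<open>e > 0\<close>, which swallows the
  2.\<close>

lemma growth_order_mono:
  assumes "growth_dominated f g"
  shows "growth_order f \<le> growth_order g"
  unfolding growth_order_def
proof (rule Inf_greatest, clarify)
  fix a :: real assume a: "a > 0" and ev: "\<forall>\<^sub>F r in at_top. ln (max_modulus g r) \<le> r powr a"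
  let ?S = "{ereal a |a. a > 0 \<and> (\<forall>\<^sub>F r in at_top. ln (max_modulus f r) \<le> r powr a)}"
  show "Inf ?S \<le> ereal a"
  proof (rule ereal_le_epsilon2)
    fix e :: real assume e: "0 < e"
    have "\<forall>\<^sub>F r in at_top. ln (max_modulus f r) \<le> 2 * r powr a"
      by (rule growth_dominatedD[OF assms a, of 1]) (use ev in auto)
    moreover have "\<forall>\<^sub>F r::real in at_top. 2 * r powr a \<le> r powr (a + e)"
      using e by real_asymp
    ultimately have "\<forall>\<^sub>F r in at_top. ln (max_modulus f r) \<le> r powr (a + e)"
      by eventually_elim auto
    then show "Inf ?S \<le> ereal a + ereal e"
      using a e by (intro Inf_lower) auto
  qed
qed

text \<open>Each type is measured against the order of its own function, so the orders must agree
  first. Positivity and finiteness turn \<open>real_of_ereal\<close> into a genuine exponent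
  \<open>a > 0\<close>, as \<open>growth_dominated\<close> requires.\<close>

lemma growth_type_mono:
  assumes "growth_dominated f g" "growth_order f = growth_order g"
    and "0 < growth_order g" "growth_order g < \<infinity>"
  shows "growth_type f \<le> growth_type g"
  unfolding growth_type_def assms(2)
proof (rule Inf_greatest, clarify)
  define a where "a = real_of_ereal (growth_order g)"
  have a: "a > 0"
    using assms(3,4) unfolding a_def by (cases "growth_order g") auto
  fix c :: real assume c: "c > 0"
    and "\<forall>\<^sub>F r in at_top. ln (max_modulus g r) \<le> c * r powr real_of_ereal (growth_order g)"
  then have ev: "\<forall>\<^sub>F r in at_top. ln (max_modulus g r) \<le> c * r powr a"
    by (simp add: a_def)
  let ?S = "{ereal c |c. c > 0 \<and> (\<forall>\<^sub>F r in at_top. ln (max_modulus f r)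
     \<le> c * r powr real_of_ereal (growth_order g))}"
  show "Inf ?S \<le> ereal c"
  proof (rule ereal_le_epsilon2)
    fix e :: real assume e: "0 < e"
    have "\<forall>\<^sub>F r in at_top. ln (max_modulus f r) \<le> (c + e) * r powr a"
      by (rule growth_dominatedD[OF assms(1) a c _ ev]) (use e in auto)
    then show "Inf ?S \<le> ereal c + ereal e"
      using c e by (intro Inf_lower) (auto simp: a_def)
  qed
qed

lemma growth_equal:
  assumes "growth_dominated f g" "growth_dominated g f"
  shows "growth_order f = growth_order g"
    and "0 < growth_order g \<Longrightarrow> growth_order g < \<infinity> \<Longrightarrow> growth_type f = growth_type g"
proof -
  show eq: "growth_order f = growth_order g"
    using assms by (intro antisym growth_order_mono)
  show "growth_type f = growth_type g" if "0 < growth_order g" "growth_order g < \<infinity>"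
    using assms eq that by (intro antisym growth_type_mono) auto
qed

text \<open>After division by \<open>r powr a\<close> the logarithmic part tends to 0 and the
  quotient of the powers to 1, so the left side tends to \<open>c < c'\<close>.\<close>

lemma powr_shift_absorb:
  fixes a c c' C k :: real
  assumes "0 < a" "c < c'"
  shows "\<forall>\<^sub>F r in at_top. C + k * ln (r + 1) + c * (r + 1) powr a \<le> c' * r powr a"
proof -
  have 1: "((\<lambda>r. (C + k * ln (r + 1)) / r powr a) \<longlongrightarrow> 0) at_top"
    using assms by real_asymp
  have 2: "((\<lambda>r::real. ((r + 1) / r) powr a) \<longlongrightarrow> 1) at_top"
    by real_asymp
  have "((\<lambda>r. (C + k * ln (r + 1)) / r powr a + c * ((r + 1) / r) powr a) \<longlongrightarrow> 0 + c * 1) at_top"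
    by (intro tendsto_intros 1 2)
  then have "\<forall>\<^sub>F r in at_top. (C + k * ln (r + 1)) / r powr a + c * ((r + 1) / r) powr a < c'"
    by (rule order_tendstoD) (use assms in auto)
  with eventually_gt_at_top[of 0] show ?thesis
  proof eventually_elim
    case (elim r)
    then show ?case by (simp add: powr_divide field_simps)
  qed
qed

lemma growth_dominatedI:
  assumes f0: "\<And>r. 0 \<le> r \<Longrightarrow> 0 \<le> max_modulus f r" and g0: "\<And>r. 0 \<le> r \<Longrightarrow> 0 \<le> max_modulus g r"
    and C: "C > 0"
    and le: "\<And>r. 0 \<le> r \<Longrightarrow> max_modulus f r \<le> C * (r + 1) ^ k * (max_modulus g (r + 1) + 1)"
  shows "growth_dominated f g"
  unfolding growth_dominated_def
proof (intro allI impI)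
  fix a c c' :: real
  assume *: "0 < a" "0 < c" "c < c'" and ev: "\<forall>\<^sub>F r in at_top. ln (max_modulus g r) \<le> c * r powr a"
  from ev have "\<forall>\<^sub>F r in at_top. ln (max_modulus g (r + 1)) \<le> c * (r + 1) powr a"
    by (rule eventually_compose_filterlim) real_asymp
  \<comment> \<open>The 2 in \<open>ln (2 * C)\<close> pays for the summand \<open>+ 1\<close>: both
    \<open>max_modulus g (r + 1)\<close> and 1 are at most \<open>?E\<close>.\<close>
  with powr_shift_absorb[OF *(1,3), of "ln (2 * C)" "real k"] eventually_ge_at_top[of 0]
  show "\<forall>\<^sub>F r in at_top. ln (max_modulus f r) \<le> c' * r powr a"
  proof eventually_elim
    case (elim r)
    let ?E = "exp (c * (r + 1) powr a)"
    have E: "1 \<le> ?E" using * by simp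
    have g: "max_modulus g (r + 1) \<le> ?E"
    \<comment> \<open>Since \<open>ln 0 = 0\<close> by default, the bound on the logarithm can be
      exponentiated only for a positive maximum modulus.\<close>
    proof (cases "max_modulus g (r + 1) = 0")
      case False
      then have "max_modulus g (r + 1) > 0" using g0[of "r + 1"] elim(2) by linarith
      then show ?thesis using elim(3) by (metis exp_le_cancel_iff exp_ln)
    qed (use E in auto)
    have "max_modulus f r \<le> C * (r + 1) ^ k * (max_modulus g (r + 1) + 1)"
      using le elim by blast
    also have "\<dots> \<le> C * (r + 1) ^ k * (2 * ?E)"
      using g E C elim(2) by (intro mult_left_mono) (simp_all del: one_le_exp_iff)
    also have "\<dots> = exp (ln (2 * C) + real k * ln (r + 1) + c * (r + 1) powr a)"
      using C elim by (simp add: exp_add exp_of_nat_mult)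
    also have "\<dots> \<le> exp (c' * r powr a)" using elim by simp
    finally have M: "max_modulus f r \<le> exp (c' * r powr a)" .
    show ?case
    proof (cases "max_modulus f r = 0")
      case False
      then show ?thesis
        using M f0[OF elim(2)] by (metis exp_gt_zero ln_exp ln_mono order_less_le)
    qed (use * in auto)
  qed
qed

text \<open>With \<open>g = ln M\<^sub>f\<close> the hypothesis reads \<open>g r \<le> g (r + 1) / 2 + O(r\<^sup>a)\<close>.  Subtracting a supersolution
  \<open>c' r\<^sup>a\<close> leaves \<open>d r \<le> d (r + 1) / 2\<close>, and polynomial growth of \<open>d\<close> forces \<open>d \<le> 0\<close>.\<close>

lemma growth_dominated_of_square_le:
  assumes f1: "\<And>r. 0 \<le> r \<Longrightarrow> 0 < max_modulus f r" and g0: "\<And>r. 0 \<le> r \<Longrightarrow> 0 \<le> max_modulus g r"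
    and C: "C > 0"
    and crude: "\<And>r. 0 \<le> r \<Longrightarrow> max_modulus f r \<le> exp (K * (1 + r)\<^sup>2)"
    and le: "\<And>r. 0 \<le> r \<Longrightarrow> (max_modulus f r)\<^sup>2
        \<le> C * (r + 1) ^ k * max_modulus f (r + 1) * max_modulus g (r + 1)"
  shows "growth_dominated f g"
  unfolding growth_dominated_def
proof (intro allI impI)
  fix a c c' :: real
  assume *: "0 < a" "0 < c" "c < c'" and ev: "\<forall>\<^sub>F r in at_top. ln (max_modulus g r) \<le> c * r powr a"
  define c2 where "c2 = (c + c') / 2"
  have c2: "c < c2" "c2 < c'" using * by (auto simp: c2_def)
  define d where "d r = ln (max_modulus f r) - c' * r powr a" for r
  from ev have "\<forall>\<^sub>F r in at_top. ln (max_modulus g (r + 1)) \<le> c * (r + 1) powr a"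
    by (rule eventually_compose_filterlim) real_asymp
  \<comment> \<open>This is the supersolution property:
    \<open>c2 * r powr a + c' * (r + 1) powr a\<close> is eventually at most
    \<open>2 * c' * r powr a\<close>, because \<open>c2 < c'\<close>.\<close>
  moreover have "\<forall>\<^sub>F r in at_top. 0 + 0 * ln (r + 1) + c' * (r + 1) powr a \<le> (2 * c' - c2) * r powr a"
    by (rule powr_shift_absorb[OF *(1)]) (use c2 in auto)
  ultimately have "\<forall>\<^sub>F r in at_top. d r \<le> d (r + 1) / 2"
    using powr_shift_absorb[OF *(1) c2(1), of "ln C" "real k"] eventually_ge_at_top[of 0]
  proof eventually_elim
    case (elim r)
    have f: "0 < max_modulus f r" "0 < max_modulus f (r + 1)" using f1 elim by auto
    have "0 < C * (r + 1) ^ k * max_modulus f (r + 1) * max_modulus g (r + 1)"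
      using le[of r] f elim by (meson order_less_le_trans zero_less_power)
    \<comment> \<open>Positivity of the square on the left forces positivity of \<open>g\<close> as
      well, so the logarithm of the product splits.\<close>
    then have g: "0 < max_modulus g (r + 1)"
      using g0[of "r + 1"] elim by (metis less_eq_real_def mult_zero_right add_nonneg_nonneg zero_le_one not_less_iff_gr_or_eq)
    have "2 * ln (max_modulus f r) = ln ((max_modulus f r)\<^sup>2)"
      using f by (simp add: ln_realpow)
    also have "\<dots> \<le> ln (C * (r + 1) ^ k * max_modulus f (r + 1) * max_modulus g (r + 1))"
      using le[of r] elim f by (intro ln_mono) (auto intro: zero_less_power)
    also have "\<dots> = ln C + real k * ln (r + 1) + ln (max_modulus f (r + 1)) + ln (max_modulus g (r + 1))"
      using C g f elim by (simp add: ln_mult ln_realpow)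
    finally show ?case using elim unfolding d_def by (simp add: algebra_simps)
  qed
  then obtain r0 where r0: "\<And>r. r \<ge> r0 \<Longrightarrow> d r \<le> d (r + 1) / 2"
    unfolding eventually_at_top_linorder by blast
  show "\<forall>\<^sub>F r in at_top. ln (max_modulus f r) \<le> c' * r powr a"
    using eventually_ge_at_top[of "max r0 0"]
  proof eventually_elim
    case (elim r)
    have "d r \<le> d (r + real n) / 2 ^ n" for n
    proof (induction n)
      case (Suc n)
      have "d (r + real n) / 2 ^ n \<le> (d (r + real n + 1) / 2) / 2 ^ n"
        using r0[of "r + real n"] elim by (intro divide_right_mono) auto
      with Suc show ?case by (simp add: algebra_simps)
    qed simp
    moreover have "d (r + real n) \<le> K * (1 + (r + real n))\<^sup>2" for n
    proof -
      have "ln (max_modulus f (r + real n)) \<le> K * (1 + (r + real n))\<^sup>2"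
        using crude[of "r + real n"] f1[of "r + real n"] elim
        by (metis add_nonneg_nonneg ln_exp ln_mono max.boundedE of_nat_0_le_iff)
      moreover have "0 \<le> c' * (r + real n) powr a" using * by auto
      ultimately show ?thesis unfolding d_def by linarith
    qed
    ultimately have "d r \<le> K * (1 + (r + real n))\<^sup>2 / 2 ^ n" for n
      by (meson divide_right_mono order_trans zero_le_numeral zero_le_power)
    moreover have "(\<lambda>n. K * (1 + (r + real n))\<^sup>2 / 2 ^ n) \<longlonglongrightarrow> 0"
      by real_asymp
    ultimately have "d r \<le> 0"
      by (meson LIMSEQ_le_const)
    then show ?case by (simp add: d_def)
  qed
qed

subsection \<open>Square-summable sequences of entire functions\<close>

text \<open>This guarantees that the supremum in \<open>max_modulus\<close> is taken over a bounded
  set. It follows directly from growth estimates, without a proof of continuity.\<close>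

definition locally_bounded :: "(complex \<Rightarrow> complex) \<Rightarrow> bool" where
  "locally_bounded f \<longleftrightarrow> (\<forall>r. \<exists>K. \<forall>z. cmod z \<le> r \<longrightarrow> cmod (f z) \<le> K)"

lemma max_modulus_ge:
  assumes "locally_bounded f" "cmod z \<le> r"
  shows "cmod (f z) \<le> max_modulus f r"
proof -
  obtain K where "\<And>z. cmod z \<le> r \<Longrightarrow> cmod (f z) \<le> K"
    using assms(1) unfolding locally_bounded_def by metis
  then have "bdd_above ((\<lambda>z. cmod (f z)) ` cball 0 r)"
    by (auto intro!: bdd_aboveI2)
  then show ?thesis
    unfolding max_modulus_def using assms(2) by (intro cSUP_upper) auto
qed

lemma max_modulus_le:
  assumes "0 \<le> r" "\<And>z. cmod z \<le> r \<Longrightarrow> cmod (f z) \<le> K"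
  shows "max_modulus f r \<le> K"
  unfolding max_modulus_def using assms by (intro cSUP_least) auto

lemma max_modulus_mono:
  assumes "locally_bounded f" "0 \<le> r" "r \<le> r'"
  shows "max_modulus f r \<le> max_modulus f r'"
  using assms by (intro max_modulus_le max_modulus_ge) auto

lemma max_modulus_nonneg:
  assumes "locally_bounded f" "0 \<le> r"
  shows "0 \<le> max_modulus f r"
  using max_modulus_ge[OF assms(1), of 0 r] assms(2) by (auto intro: order_trans[OF norm_ge_zero])

section \<open>Square-summable sequences and their finite sections\<close>

definition l2 :: "(nat \<Rightarrow> complex) \<Rightarrow> bool" where
  "l2 f \<longleftrightarrow> summable (\<lambda>n. (cmod (f n))\<^sup>2)"

definition l2norm :: "(nat \<Rightarrow> complex) \<Rightarrow> real" where
  "l2norm f = sqrt (\<Sum>n. (cmod (f n))\<^sup>2)"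

lemma l2norm_nonneg: "l2 f \<Longrightarrow> 0 \<le> l2norm f"
  by (simp add: l2norm_def l2_def suminf_nonneg)

lemma l2norm_power2: "l2 f \<Longrightarrow> (l2norm f)\<^sup>2 = (\<Sum>n. (cmod (f n))\<^sup>2)"
  by (simp add: l2norm_def l2_def suminf_nonneg)

lemma sum_le_l2norm_power2: "l2 f \<Longrightarrow> (\<Sum>n<N. (cmod (f n))\<^sup>2) \<le> (l2norm f)\<^sup>2"
  unfolding l2norm_power2 unfolding l2_def by (rule sum_le_suminf) auto

lemma L2_set_le_l2norm: "l2 f \<Longrightarrow> L2_set (\<lambda>n. cmod (f n)) {..<N} \<le> l2norm f"
  unfolding L2_set_def by (rule real_le_lsqrt) (auto intro: sum_le_l2norm_power2 l2norm_nonneg)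

lemma norm_le_l2norm: "l2 f \<Longrightarrow> cmod (f n) \<le> l2norm f"
  using L2_set_le_l2norm[of f "Suc n"] member_le_L2_set[of "{..<Suc n}" n "\<lambda>n. cmod (f n)"]
  by simp

lemma L2_set_tendsto_l2norm:
  assumes "l2 f"
  shows "(\<lambda>N. L2_set (\<lambda>n. cmod (f n)) {..<N}) \<longlonglongrightarrow> l2norm f"
  unfolding L2_set_def l2norm_def using assms unfolding l2_def
  by (intro tendsto_real_sqrt summable_LIMSEQ)

text \<open>The passage from finite sections to the whole sequence: a uniform bound gives
  convergence and the norm estimate at once.\<close>

lemma l2_of_L2_set_le:
  assumes "\<And>N. L2_set (\<lambda>n. cmod (f n)) {..<N} \<le> K"
  shows "l2 f" "l2norm f \<le> K"
proof -
  have "0 \<le> K" using assms[of 0] by simp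
  then have "(\<Sum>n<N. (cmod (f n))\<^sup>2) \<le> K\<^sup>2" for N
    using assms[of N] unfolding L2_set_def by (simp add: sqrt_le_D)
  then show "l2 f" unfolding l2_def by (intro summableI_nonneg_bounded) auto
  from L2_set_tendsto_l2norm[OF this] show "l2norm f \<le> K"
    by (rule LIMSEQ_le_const2) (use assms in auto)
qed

lemma norm_sum_mult_le_L2_set:
  "cmod (\<Sum>n<N. f n * g n) \<le> L2_set (\<lambda>n. cmod (f n)) {..<N} * L2_set (\<lambda>n. cmod (g n)) {..<N}"
  by (rule order_trans[OF sum_norm_le L2_set_mult_ineq]) (simp add: norm_mult)

lemma l2_mult:
  assumes "l2 f" "l2 g"
  shows "summable (\<lambda>n. f n * g n)" "cmod (\<Sum>n. f n * g n) \<le> l2norm f * l2norm g"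
proof -
  have *: "(\<Sum>n<N. cmod (f n * g n)) \<le> l2norm f * l2norm g" for N
  proof -
    have "(\<Sum>n<N. cmod (f n * g n)) = (\<Sum>n<N. \<bar>cmod (f n)\<bar> * \<bar>cmod (g n)\<bar>)"
      by (simp add: norm_mult)
    also have "\<dots> \<le> L2_set (\<lambda>n. cmod (f n)) {..<N} * L2_set (\<lambda>n. cmod (g n)) {..<N}"
      by (rule L2_set_mult_ineq)
    also have "\<dots> \<le> l2norm f * l2norm g"
      using assms by (intro mult_mono L2_set_le_l2norm l2norm_nonneg) auto
    finally show ?thesis .
  qed
  have sm: "summable (\<lambda>n. cmod (f n * g n))"
    by (rule summableI_nonneg_bounded[OF _ *]) simp
  have le: "(\<Sum>n. cmod (f n * g n)) \<le> l2norm f * l2norm g"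
    by (rule suminf_le_const[OF sm *])
  from sm show "summable (\<lambda>n. f n * g n)" by (rule summable_norm_cancel)
  from summable_norm[OF sm] le show "cmod (\<Sum>n. f n * g n) \<le> l2norm f * l2norm g" by linarith
qed

lemma l2_add:
  assumes "l2 f" "l2 g"
  shows "l2 (\<lambda>n. f n + g n)" "l2norm (\<lambda>n. f n + g n) \<le> l2norm f + l2norm g"
proof -
  have "L2_set (\<lambda>n. cmod (f n + g n)) {..<N} \<le> l2norm f + l2norm g" for N
  proof -
    have "L2_set (\<lambda>n. cmod (f n + g n)) {..<N} \<le> L2_set (\<lambda>n. cmod (f n) + cmod (g n)) {..<N}"
      by (intro L2_set_mono norm_triangle_ineq) auto
    also have "\<dots> \<le> L2_set (\<lambda>n. cmod (f n)) {..<N} + L2_set (\<lambda>n. cmod (g n)) {..<N}"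
      by (rule L2_set_triangle_ineq)
    also have "\<dots> \<le> l2norm f + l2norm g"
      using assms by (intro add_mono L2_set_le_l2norm)
    finally show ?thesis .
  qed
  from l2_of_L2_set_le[OF this]
  show "l2 (\<lambda>n. f n + g n)" "l2norm (\<lambda>n. f n + g n) \<le> l2norm f + l2norm g" by auto
qed

lemma l2_cmult:
  assumes "l2 f"
  shows "l2 (\<lambda>n. c * f n)" "l2norm (\<lambda>n. c * f n) = cmod c * l2norm f"
  using assms unfolding l2_def l2norm_def
  by (simp_all add: norm_mult power_mult_distrib suminf_mult real_sqrt_mult summable_mult)

text \<open>The equality case of Cauchy-Schwarz. Pairing with the conjugate of a fixed vector turns
  vector-valued estimates into scalar ones without loss at that vector.\<close>

lemma norm_sum_cnj_mult_self:
  "cmod (\<Sum>n<N. cnj (f n) * f n) = (L2_set (\<lambda>n. cmod (f n)) {..<N})\<^sup>2"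
proof -
  have "(\<Sum>n<N. cnj (f n) * f n) = complex_of_real (\<Sum>n<N. (cmod (f n))\<^sup>2)"
    unfolding of_real_sum by (intro sum.cong refl) (simp only: complex_norm_square mult.commute)
  then show ?thesis
    by (simp add: L2_set_def sum_nonneg norm_of_real del: of_real_sum)
qed

text \<open>On \<open>|z| = R\<close> one has \<open>|z\<^sup>2 - R\<^sup>2| = 2 R |Im z|\<close>, so multiplying by powers of \<open>z\<^sup>2 - R\<^sup>2\<close> removes
  the singularity on the real axis before the maximum principle is applied.\<close>

lemma l2norm_max_principle:
  assumes hol: "\<And>n. y n holomorphic_on UNIV" and l2: "\<And>z. l2 (\<lambda>n. y n z)"
    and "0 < j" "1 \<le> R" and z: "cmod z \<le> R - 1"
    and bound: "\<And>z. cmod z = R \<Longrightarrow> \<bar>Im z\<bar> ^ m * l2norm (\<lambda>n. y n z) ^ j \<le> K"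
  shows "l2norm (\<lambda>n. y n z) ^ j \<le> 2 ^ m * K"
proof -
  have K: "0 \<le> K"
    by (rule order_trans[OF _ bound[of "of_real R"]])
      (use \<open>1 \<le> R\<close> l2norm_nonneg[OF l2] in \<open>auto intro!: mult_nonneg_nonneg zero_le_power\<close>)
  have "(L2_set (\<lambda>n. cmod (y n z)) {..<N}) ^ j \<le> 2 ^ m * K" for N
  proof -
    define s where "s = L2_set (\<lambda>n. cmod (y n z)) {..<N}"
    \<comment> \<open>The conjugated vector is frozen at \<open>z\<close>, so \<open>f\<close> is
      holomorphic. Its modulus is \<open>s\<^sup>2\<close> at \<open>z\<close>, and at most
      \<open>s\<close> times the norm elsewhere.\<close>
    define f where "f \<zeta> = (\<Sum>n<N. cnj (y n z) * y n \<zeta>)" for \<zeta>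
    define g where "g \<zeta> = f \<zeta> ^ j * (\<zeta>\<^sup>2 - (of_real R)\<^sup>2) ^ m" for \<zeta>
    have s0: "0 \<le> s" unfolding s_def by simp
    have holg: "g holomorphic_on UNIV" unfolding g_def f_def
      by (intro holomorphic_intros hol)
    have "cmod (g z) \<le> s ^ j * (2 * R) ^ m * K"
    proof (rule maximum_modulus_frontier[of g "cball 0 R"])
      show "g holomorphic_on interior (cball 0 R)" "continuous_on (closure (cball 0 R)) g"
        using holg holomorphic_on_imp_continuous_on holomorphic_on_subset by blast+
      show "z \<in> cball 0 R" using z by simp
      fix \<zeta> :: complex assume "\<zeta> \<in> frontier (cball 0 R)"
      then have \<zeta>: "cmod \<zeta> = R" using \<open>1 \<le> R\<close> by simp
      have "(of_real R)\<^sup>2 = \<zeta> * cnj \<zeta>"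
        using \<zeta> complex_norm_square[of \<zeta>] by simp
      then have "\<zeta>\<^sup>2 - (of_real R)\<^sup>2 = \<zeta> * (\<zeta> - cnj \<zeta>)"
        by (simp add: power2_eq_square algebra_simps)
      then have 1: "cmod (\<zeta>\<^sup>2 - (of_real R)\<^sup>2) = 2 * R * \<bar>Im \<zeta>\<bar>"
        by (simp add: norm_mult \<zeta> complex_diff_cnj)
      have "cmod (f \<zeta>) \<le> s * l2norm (\<lambda>n. y n \<zeta>)"
        unfolding f_def s_def
        by (rule order_trans[OF norm_sum_mult_le_L2_set])
          (auto intro!: mult_left_mono L2_set_le_l2norm l2)
      then have "cmod (f \<zeta>) ^ j \<le> (s * l2norm (\<lambda>n. y n \<zeta>)) ^ j"
        by (intro power_mono) auto
      then have "cmod (g \<zeta>) \<le> (s * l2norm (\<lambda>n. y n \<zeta>)) ^ j * (2 * R * \<bar>Im \<zeta>\<bar>) ^ m"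
        unfolding g_def norm_mult norm_power 1 using \<open>1 \<le> R\<close> by (intro mult_right_mono) auto
      also have "\<dots> = s ^ j * (2 * R) ^ m * (\<bar>Im \<zeta>\<bar> ^ m * l2norm (\<lambda>n. y n \<zeta>) ^ j)"
        by (simp add: power_mult_distrib)
      also have "\<dots> \<le> s ^ j * (2 * R) ^ m * K"
        using s0 \<open>1 \<le> R\<close> by (intro mult_left_mono bound \<zeta>) auto
      finally show "cmod (g \<zeta>) \<le> s ^ j * (2 * R) ^ m * K" .
    qed auto
    \<comment> \<open>As \<open>z\<close> has distance at least 1 from the circle, the inserted
      factor has modulus at least \<open>R\<close> there. Against \<open>(2 * R) ^ m\<close> on the
      circle only \<open>2 ^ m\<close> survives.\<close>
    moreover have "cmod (g z) \<ge> (s\<^sup>2) ^ j * R ^ m"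
    proof -
      have "(cmod z)\<^sup>2 \<le> (R - 1)\<^sup>2" using z by (intro power_mono) auto
      also have "\<dots> \<le> R\<^sup>2 - R" using \<open>1 \<le> R\<close> by (simp add: power2_eq_square algebra_simps)
      finally have "R \<le> R\<^sup>2 - (cmod z)\<^sup>2" by simp
      also have "\<dots> \<le> cmod (z\<^sup>2 - (of_real R)\<^sup>2)"
        using norm_triangle_ineq2[of "(of_real R)\<^sup>2" "z\<^sup>2"] \<open>1 \<le> R\<close>
        by (simp add: norm_power norm_minus_commute)
      finally have "R ^ m \<le> cmod (z\<^sup>2 - (of_real R)\<^sup>2) ^ m"
        using \<open>1 \<le> R\<close> by (intro power_mono) auto
      moreover have "cmod (f z) = s\<^sup>2"
        unfolding f_def s_def by (rule norm_sum_cnj_mult_self)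
      ultimately show ?thesis
        unfolding g_def norm_mult norm_power by (auto intro!: mult_left_mono)
    qed
    ultimately have "(s\<^sup>2) ^ j * R ^ m \<le> s ^ j * (2 * R) ^ m * K"
      by linarith
    moreover have "(s\<^sup>2) ^ j * R ^ m = s ^ j * R ^ m * s ^ j"
      by (simp only: power2_eq_square power_mult_distrib mult_ac)
    moreover have "s ^ j * (2 * R) ^ m * K = s ^ j * R ^ m * (2 ^ m * K)"
      by (simp only: power_mult_distrib mult_ac)
    ultimately have *: "s ^ j * R ^ m * s ^ j \<le> s ^ j * R ^ m * (2 ^ m * K)"
      by metis
    show ?thesis
    proof (cases "s = 0")
      case True
      then show ?thesis using K \<open>0 < j\<close> unfolding s_def[symmetric] by (simp add: zero_power)
    next
      case False
      then have "0 < s ^ j * R ^ m" using s0 \<open>1 \<le> R\<close> by simp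
      with * show ?thesis unfolding s_def[symmetric] by (rule mult_left_le_imp_le)
    qed
  qed
  moreover have "(\<lambda>N. (L2_set (\<lambda>n. cmod (y n z)) {..<N}) ^ j) \<longlonglongrightarrow> l2norm (\<lambda>n. y n z) ^ j"
    by (intro tendsto_intros L2_set_tendsto_l2norm l2)
  ultimately show ?thesis by (meson LIMSEQ_le_const2)
qed

subsection \<open>Solutions of the recurrence\<close>

text \<open>The recurrence is a discrete variation of constants: values at \<open>z\<close> are
  expressed through those at \<open>w\<close>, with a kernel built from the two solutions
  \<open>p\<close> and \<open>q\<close> at \<open>w\<close>. It will hold for the polynomials of
  both kinds.\<close>

locale solution_family =
  fixes p q y :: "nat \<Rightarrow> complex \<Rightarrow> complex"
  assumes recurrence: "y n z = y n w
      + (z - w) * (\<Sum>k<n. (q n w * p k w - p n w * q k w) * y k z)"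
    and cnj_y: "y n (cnj z) = cnj (y n z)"
    and cnj_p: "p n (cnj z) = cnj (p n z)"
    and cnj_q: "q n (cnj z) = cnj (q n z)"
begin

text \<open>With base point 0 the recurrence writes \<open>y n\<close> as a constant plus
  \<open>z\<close> times a combination of earlier terms.\<close>

lemma holomorphic: "y n holomorphic_on UNIV"
proof (induction n rule: less_induct)
  case (less n)
  then have "(\<lambda>z. y n 0 + (z - 0) * (\<Sum>k<n. (q n 0 * p k 0 - p n 0 * q k 0) * y k z)) holomorphic_on UNIV"
    by (intro holomorphic_intros) auto
  then show ?case by (rule holomorphic_transform) (rule recurrence[symmetric])
qed

text \<open>The kernel of the recurrence is square summable, so that a discrete Gronwall argument applies.\<close>

lemma gronwall:
  assumes p: "l2 (\<lambda>n. p n w)" and q: "l2 (\<lambda>n. q n w)" and y: "l2 (\<lambda>n. y n w)"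
  obtains K where "0 < K" "\<And>z. l2 (\<lambda>n. y n z)"
    "\<And>z. l2norm (\<lambda>n. y n z) \<le> K * exp (K * (cmod (z - w))\<^sup>2)"
proof -
  \<comment> \<open>\<open>b n\<close> bounds the squared norm of row \<open>n\<close> of the kernel
    at \<open>w\<close>, and is summable because the values of \<open>p\<close> and \<open>q\<close>
    at \<open>w\<close> are square summable.\<close>
  define b where "b n = 2 * ((cmod (q n w))\<^sup>2 * (l2norm (\<lambda>n. p n w))\<^sup>2
      + (cmod (p n w))\<^sup>2 * (l2norm (\<lambda>n. q n w))\<^sup>2)" for n
  have b0: "0 \<le> b n" for n by (simp add: b_def)
  have sb: "summable b"
    unfolding b_def using p q unfolding l2_def by (intro summable_add summable_mult summable_mult2)
  define B where "B = suminf b"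
  have B: "(\<Sum>k<n. b k) \<le> B" for n
    unfolding B_def by (rule sum_le_suminf[OF sb]) (auto simp: b0)
  have B0: "0 \<le> B" using B[of 0] by simp
  define Y where "Y = (l2norm (\<lambda>n. y n w))\<^sup>2"
  have Y: "(\<Sum>k<n. (cmod (y k w))\<^sup>2) \<le> Y" for n
    unfolding Y_def by (rule sum_le_l2norm_power2[OF y])
  have Y0: "0 \<le> Y" using Y[of 0] by simp
  have a: "(\<Sum>k<n. (cmod (q n w * p k w - p n w * q k w))\<^sup>2) \<le> b n" for n
  proof -
    have "(cmod (u - v))\<^sup>2 \<le> 2 * (cmod u)\<^sup>2 + 2 * (cmod v)\<^sup>2" for u v
    proof -
      have "(cmod (u - v))\<^sup>2 \<le> (cmod u + cmod v)\<^sup>2"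
        by (intro power_mono norm_triangle_ineq4) auto
      also have "\<dots> \<le> 2 * (cmod u)\<^sup>2 + 2 * (cmod v)\<^sup>2"
        using sum_squares_ge_zero[of "cmod u - cmod v" 0] by (simp add: power2_eq_square algebra_simps)
      finally show ?thesis .
    qed
    then have "(\<Sum>k<n. (cmod (q n w * p k w - p n w * q k w))\<^sup>2)
        \<le> (\<Sum>k<n. 2 * (cmod (q n w * p k w))\<^sup>2 + 2 * (cmod (p n w * q k w))\<^sup>2)"
      by (intro sum_mono)
    also have "\<dots> = 2 * ((cmod (q n w))\<^sup>2 * (\<Sum>k<n. (cmod (p k w))\<^sup>2)
        + (cmod (p n w))\<^sup>2 * (\<Sum>k<n. (cmod (q k w))\<^sup>2))"
      by (simp add: sum.distrib norm_mult power_mult_distrib sum_distrib_left mult_ac)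
    also have "\<dots> \<le> b n"
      unfolding b_def by (intro mult_left_mono add_mono sum_le_l2norm_power2 p q) auto
    finally show ?thesis .
  qed
  have main: "(\<Sum>k<n. (cmod (y k z))\<^sup>2)
      \<le> 2 * (\<Sum>k<n. (cmod (y k w))\<^sup>2) * exp (2 * (cmod (z - w))\<^sup>2 * (\<Sum>k<n. b k))" for n z
  proof (induction n)
    case (Suc n)
    define T where "T = (\<Sum>k<n. (cmod (y k z))\<^sup>2)"
    define V where "V = (\<Sum>k<n. (cmod (y k w))\<^sup>2)"
    define x where "x = 2 * (cmod (z - w))\<^sup>2"
    define E where "E = exp (x * (\<Sum>k<n. b k))"
    have T0: "0 \<le> T" and V0: "0 \<le> V" and x0: "0 \<le> x" unfolding T_def V_def x_def
      by (auto intro: sum_nonneg)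
    have E1: "1 \<le> E" unfolding E_def using x0 b0 by (simp add: sum_nonneg)
    have IH: "T \<le> 2 * V * E" using Suc unfolding T_def V_def E_def x_def by simp
    let ?S = "\<Sum>k<n. (q n w * p k w - p n w * q k w) * y k z"
    have "cmod ?S \<le> L2_set (\<lambda>k. cmod (q n w * p k w - p n w * q k w)) {..<n} * L2_set (\<lambda>k. cmod (y k z)) {..<n}"
      by (rule norm_sum_mult_le_L2_set)
    then have "(cmod ?S)\<^sup>2 \<le> (L2_set (\<lambda>k. cmod (q n w * p k w - p n w * q k w)) {..<n} * L2_set (\<lambda>k. cmod (y k z)) {..<n})\<^sup>2"
      by (intro power_mono) auto
    also have "\<dots> = (\<Sum>k<n. (cmod (q n w * p k w - p n w * q k w))\<^sup>2) * T"
      unfolding T_def L2_set_def by (simp add: power_mult_distrib sum_nonneg)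
    also have "\<dots> \<le> b n * T" using a T0 by (intro mult_right_mono)
    finally have S: "(cmod ?S)\<^sup>2 \<le> b n * T" .
    have "cmod (y n z) \<le> cmod (y n w) + cmod (z - w) * cmod ?S"
      using norm_triangle_ineq[of "y n w" "(z - w) * ?S"]
      unfolding recurrence[of n z w, symmetric] norm_mult .
    then have "(cmod (y n z))\<^sup>2 \<le> (cmod (y n w) + cmod (z - w) * cmod ?S)\<^sup>2"
      by (intro power_mono) auto
    also have "\<dots> \<le> 2 * (cmod (y n w))\<^sup>2 + 2 * (cmod (z - w) * cmod ?S)\<^sup>2"
      using sum_squares_ge_zero[of "cmod (y n w) - cmod (z - w) * cmod ?S" 0]
      by (simp add: power2_eq_square algebra_simps)
    also have "2 * (cmod (z - w) * cmod ?S)\<^sup>2 = x * (cmod ?S)\<^sup>2"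
      by (simp add: x_def power_mult_distrib)
    also have "x * (cmod ?S)\<^sup>2 \<le> x * (b n * T)" using S x0 by (rule mult_left_mono)
    finally have yn: "(cmod (y n z))\<^sup>2 \<le> 2 * (cmod (y n w))\<^sup>2 + x * (b n * T)" by simp
    have "T + (cmod (y n z))\<^sup>2 \<le> T * (1 + x * b n) + 2 * (cmod (y n w))\<^sup>2"
      using yn by (simp add: algebra_simps)
    \<comment> \<open>The growth factor \<open>1 + x * b n\<close> is replaced by an exponential, so
      the steps multiply up to one exponential of the sum of \<open>b\<close>. The new term fits
      since the exponential factor is at least 1.\<close>
    also have "\<dots> \<le> (2 * V * E) * exp (x * b n) + 2 * (cmod (y n w))\<^sup>2 * (E * exp (x * b n))"
    proof (rule add_mono)
      show "T * (1 + x * b n) \<le> (2 * V * E) * exp (x * b n)"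
        using V0 E1 x0 b0 by (intro mult_mono IH exp_ge_add_one_self) auto
      have "1 * 1 \<le> E * exp (x * b n)"
        using E1 x0 b0 by (intro mult_mono) auto
      then show "2 * (cmod (y n w))\<^sup>2 \<le> 2 * (cmod (y n w))\<^sup>2 * (E * exp (x * b n))"
        by (simp add: mult_le_cancel_left1)
    qed
    also have "\<dots> = 2 * (V + (cmod (y n w))\<^sup>2) * (E * exp (x * b n))"
      by (simp add: algebra_simps)
    also have "E * exp (x * b n) = exp (x * (\<Sum>k<Suc n. b k))"
      by (simp add: E_def exp_add distrib_left)
    finally show ?case unfolding T_def V_def x_def by simp
  qed simp
  \<comment> \<open>One constant serves as prefactor and in the exponent. The summand 1 makes the
    bound at least 1, hence at most its own square, so it also bounds the square root.\<close>
  define K where "K = 2 * Y + 2 * B + 1"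
  have L2: "L2_set (\<lambda>n. cmod (y n z)) {..<N} \<le> K * exp (K * (cmod (z - w))\<^sup>2)" for N z
  proof -
    have "2 * (\<Sum>k<N. (cmod (y k w))\<^sup>2) * exp (2 * (cmod (z - w))\<^sup>2 * (\<Sum>k<N. b k))
        \<le> K * exp (K * (cmod (z - w))\<^sup>2)"
    proof (intro mult_mono)
      show "2 * (\<Sum>k<N. (cmod (y k w))\<^sup>2) \<le> K" using Y[of N] B0 by (simp add: K_def)
      have "2 * (\<Sum>k<N. b k) * (cmod (z - w))\<^sup>2 \<le> K * (cmod (z - w))\<^sup>2"
        using B[of N] Y0 B0 by (intro mult_right_mono) (auto simp: K_def)
      then show "exp (2 * (cmod (z - w))\<^sup>2 * (\<Sum>k<N. b k)) \<le> exp (K * (cmod (z - w))\<^sup>2)"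
        by (simp add: mult_ac)
    qed (use Y0 B0 in \<open>auto simp: K_def\<close>)
    with main[where n=N and z=z] have le: "(\<Sum>k<N. (cmod (y k z))\<^sup>2) \<le> K * exp (K * (cmod (z - w))\<^sup>2)"
      by linarith
    have "1 * 1 \<le> K * exp (K * (cmod (z - w))\<^sup>2)"
      using Y0 B0 by (intro mult_mono) (auto simp: K_def)
    then have "K * exp (K * (cmod (z - w))\<^sup>2) \<le> (K * exp (K * (cmod (z - w))\<^sup>2))\<^sup>2"
      by (simp add: self_le_power)
    with le show ?thesis
      unfolding L2_set_def using \<open>1 * 1 \<le> _\<close> by (intro real_le_lsqrt) (auto intro: sum_nonneg)
  qed
  show ?thesis
    using that[of K] l2_of_L2_set_le[OF L2] Y0 B0 by (auto simp: K_def)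
qed

end

text \<open>The pair \<open>(X, Y)\<close> below is \<open>(D, B)\<close> for \<open>y = P\<close> and \<open>(C, A)\<close> for \<open>y = Q\<close>.\<close>

locale nevanlinna_pair = solution_family +
  fixes x0 y0 :: real
  assumes initial: "y n 0 = q n 0 * of_real x0 - p n 0 * of_real y0"
    and l2_p: "l2 (\<lambda>n. p n 0)" and l2_q: "l2 (\<lambda>n. q n 0)"
    and nonzero: "\<exists>n. y n 0 \<noteq> 0"
begin

definition N where "N z = complex_of_real (l2norm (\<lambda>n. y n z))"
definition X where "X z = of_real x0 + z * (\<Sum>k. p k 0 * y k z)"
definition Y where "Y z = of_real y0 + z * (\<Sum>k. q k 0 * y k z)"

lemma l2_y0: "l2 (\<lambda>n. y n 0)"
proof -
  have "l2 (\<lambda>n. of_real x0 * q n 0 + (- of_real y0) * p n 0)"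
    by (intro l2_add l2_cmult l2_p l2_q)
  then show ?thesis by (subst initial) (simp add: mult.commute)
qed

lemma crude:
  obtains K where "0 < K" "\<And>z. l2norm (\<lambda>n. y n z) \<le> K * exp (K * (cmod z)\<^sup>2)"
  using gronwall[OF l2_p l2_q l2_y0] by (metis diff_zero)

lemma l2_y: "l2 (\<lambda>n. y n z)"
  using gronwall[OF l2_p l2_q l2_y0] by metis

lemma norm_N [simp]: "cmod (N z) = l2norm (\<lambda>n. y n z)"
  by (simp add: N_def l2norm_nonneg l2_y)

lemma locally_bounded_N: "locally_bounded N"
proof -
  obtain K where K: "0 < K" "\<And>z. l2norm (\<lambda>n. y n z) \<le> K * exp (K * (cmod z)\<^sup>2)"
    using crude by blast
  show ?thesis unfolding locally_bounded_def
  proof (intro allI exI impI)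
    fix r z assume "cmod z \<le> r"
    then have "K * exp (K * (cmod z)\<^sup>2) \<le> K * exp (K * r\<^sup>2)"
      using K(1) by (simp add: power_mono)
    then show "cmod (N z) \<le> K * exp (K * r\<^sup>2)" using K(2)[of z] by simp
  qed
qed

lemma max_modulus_N_pos: "0 \<le> r \<Longrightarrow> l2norm (\<lambda>n. y n 0) \<le> max_modulus N r" "0 < l2norm (\<lambda>n. y n 0)"
proof -
  show "0 < l2norm (\<lambda>n. y n 0)"
    using nonzero norm_le_l2norm[OF l2_y0] by (metis zero_less_norm_iff order_less_le_trans)
  show "0 \<le> r \<Longrightarrow> l2norm (\<lambda>n. y n 0) \<le> max_modulus N r"
    using max_modulus_ge[OF locally_bounded_N, of 0 r] by simp
qed

text \<open>The a priori bound needed for the iteration in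
  \<open>growth_dominated_of_square_le\<close>. The prefactor \<open>K\<close> is absorbed through
  \<open>K \<le> exp K\<close>.\<close>

lemma crude_max_modulus:
  obtains K where "\<And>r. 0 \<le> r \<Longrightarrow> max_modulus N r \<le> exp (K * (1 + r)\<^sup>2)"
proof -
  obtain K where K: "0 < K" "\<And>z. l2norm (\<lambda>n. y n z) \<le> K * exp (K * (cmod z)\<^sup>2)"
    using crude by blast
  have "max_modulus N r \<le> exp ((2 * K) * (1 + r)\<^sup>2)" if "0 \<le> r" for r
  proof (rule max_modulus_le[OF that])
    fix z assume z: "cmod z \<le> r"
    have "K \<le> exp K" using exp_ge_add_one_self[of K] by linarith
    also have "exp K \<le> exp (K * (1 + r)\<^sup>2)" using K(1) that by (simp add: self_le_power)
    finally have 1: "K \<le> exp (K * (1 + r)\<^sup>2)" .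
    have "K * (cmod z)\<^sup>2 \<le> K * (1 + r)\<^sup>2" using K(1) z by (intro mult_left_mono power_mono) auto
    then have "K * exp (K * (cmod z)\<^sup>2) \<le> exp (K * (1 + r)\<^sup>2) * exp (K * (1 + r)\<^sup>2)"
      using 1 K(1) by (intro mult_mono) auto
    also have "\<dots> = exp ((2 * K) * (1 + r)\<^sup>2)" by (simp add: exp_add [symmetric])
    finally show "cmod (N z) \<le> exp ((2 * K) * (1 + r)\<^sup>2)" using K(2)[of z] by simp
  qed
  then show ?thesis using that by blast
qed

text \<open>The left side is a discrete Wronskian. Passing from \<open>n\<close> to
  \<open>n + 1\<close> increases it by exactly \<open>(z - w) * y n z * y n w\<close>.\<close>

lemma christoffel_darboux:
  fixes n
  defines "Xn \<equiv> \<lambda>n z. of_real x0 + z * (\<Sum>k<n. p k 0 * y k z)"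
    and "Yn \<equiv> \<lambda>n z. of_real y0 + z * (\<Sum>k<n. q k 0 * y k z)"
  shows "Yn n z * Xn n w - Xn n z * Yn n w = (z - w) * (\<Sum>k<n. y k z * y k w)"
proof (induction n)
  case 0
  show ?case by (simp add: Xn_def Yn_def)
next
  case (Suc n)
  \<comment> \<open>The starting values \<open>x0\<close> and \<open>y0\<close> were chosen so that
    the recurrence based at 0 takes this form.\<close>
  have y: "y n z = q n 0 * Xn n z - p n 0 * Yn n z" for z
    by (subst recurrence[of n z 0])
      (simp add: Xn_def Yn_def initial sum_subtractf sum_distrib_left algebra_simps)
  have X: "Xn (Suc n) z = Xn n z + z * p n 0 * y n z" and Y: "Yn (Suc n) z = Yn n z + z * q n 0 * y n z" for z
    by (simp_all add: Xn_def Yn_def algebra_simps)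
  have "Yn (Suc n) z * Xn (Suc n) w - Xn (Suc n) z * Yn (Suc n) w
      = (Yn n z * Xn n w - Xn n z * Yn n w) - w * y n w * (q n 0 * Xn n z - p n 0 * Yn n z)
        + z * y n z * (q n 0 * Xn n w - p n 0 * Yn n w)"
    unfolding X Y by (simp add: algebra_simps)
  also have "\<dots> = (z - w) * (\<Sum>k<n. y k z * y k w) + (z - w) * (y n z * y n w)"
    unfolding Suc y[symmetric] by (simp add: algebra_simps)
  finally show ?case by (simp add: algebra_simps)
qed

text \<open>Taking \<open>w = cnj z\<close> in \<open>christoffel_darboux\<close> turns the sum into
  the squared norm. The values of \<open>p\<close> and \<open>q\<close> at 0 are real, so the left
  side consists of two products of equal modulus.\<close>

lemma Im_mult_l2norm_le: "\<bar>Im z\<bar> * (l2norm (\<lambda>n. y n z))\<^sup>2 \<le> cmod (X z) * cmod (Y z)"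
proof -
  define Xn where "Xn = (\<lambda>n z. of_real x0 + z * (\<Sum>k<n. p k 0 * y k z))"
  define Yn where "Yn = (\<lambda>n z. of_real y0 + z * (\<Sum>k<n. q k 0 * y k z))"
  have real: "cnj (p k 0) = p k 0" "cnj (q k 0) = q k 0" for k
    using cnj_p[of k 0] cnj_q[of k 0] by auto
  have cX: "Xn n (cnj z) = cnj (Xn n z)" and cY: "Yn n (cnj z) = cnj (Yn n z)" for n
    by (simp_all add: Xn_def Yn_def cnj_y real)
  have le: "\<bar>Im z\<bar> * (L2_set (\<lambda>k. cmod (y k z)) {..<n})\<^sup>2 \<le> cmod (Xn n z) * cmod (Yn n z)" for n
  proof -
    have "2 * (\<bar>Im z\<bar> * (L2_set (\<lambda>k. cmod (y k z)) {..<n})\<^sup>2)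
        = cmod ((z - cnj z) * (\<Sum>k<n. cnj (y k z) * y k z))"
      unfolding norm_mult norm_sum_cnj_mult_self by (simp add: complex_diff_cnj norm_mult)
    also have "\<dots> = cmod (Yn n z * cnj (Xn n z) - Xn n z * cnj (Yn n z))"
      using christoffel_darboux[where n = n and z = z and w = "cnj z"] unfolding Xn_def[symmetric] Yn_def[symmetric] cX[symmetric] cY[symmetric]
      by (simp add: Xn_def Yn_def cnj_y mult_ac)
    also have "\<dots> \<le> cmod (Yn n z * cnj (Xn n z)) + cmod (Xn n z * cnj (Yn n z))"
      by (rule norm_triangle_ineq4)
    also have "\<dots> = 2 * (cmod (Xn n z) * cmod (Yn n z))"
      by (simp add: norm_mult)
    finally show ?thesis by simp
  qed
  have "(\<lambda>n. Xn n z) \<longlonglongrightarrow> X z" "(\<lambda>n. Yn n z) \<longlonglongrightarrow> Y z"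
    unfolding Xn_def Yn_def X_def Y_def
    by (intro tendsto_intros summable_LIMSEQ l2_mult l2_p l2_q l2_y)+
  then have "(\<lambda>n. cmod (Xn n z) * cmod (Yn n z)) \<longlonglongrightarrow> cmod (X z) * cmod (Y z)"
    by (intro tendsto_intros)
  moreover have "(\<lambda>n. \<bar>Im z\<bar> * (L2_set (\<lambda>k. cmod (y k z)) {..<n})\<^sup>2)
      \<longlonglongrightarrow> \<bar>Im z\<bar> * (l2norm (\<lambda>n. y n z))\<^sup>2"
    by (intro tendsto_intros L2_set_tendsto_l2norm l2_y)
  ultimately show ?thesis using le by (meson LIMSEQ_le)
qed

lemma norm_XY_le:
  obtains C where "0 < C" "\<And>z. cmod (X z) \<le> C * (cmod z + 1) * (cmod (N z) + 1)"
    "\<And>z. cmod (Y z) \<le> C * (cmod z + 1) * (cmod (N z) + 1)"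
proof -
  have gen: "cmod (of_real c + z * (\<Sum>k. u k * y k z)) \<le> K * (cmod z + 1) * (cmod (N z) + 1)"
    if u: "l2 u" and K: "\<bar>c\<bar> \<le> K" "l2norm u \<le> K" for c :: real and u :: "nat \<Rightarrow> complex" and K z
  proof -
    have N: "0 \<le> cmod (N z)" by (rule norm_ge_zero)
    have "cmod (of_real c + z * (\<Sum>k. u k * y k z)) \<le> \<bar>c\<bar> + cmod z * cmod (\<Sum>k. u k * y k z)"
      by (rule order_trans[OF norm_triangle_ineq]) (simp add: norm_mult)
    also have "\<dots> \<le> K + cmod z * (K * cmod (N z))"
    proof (intro add_mono K mult_left_mono)
      have "cmod (\<Sum>k. u k * y k z) \<le> l2norm u * l2norm (\<lambda>k. y k z)"
        by (rule l2_mult[OF u l2_y])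
      also have "\<dots> \<le> K * l2norm (\<lambda>k. y k z)"
        using K by (intro mult_right_mono l2norm_nonneg l2_y)
      finally show "cmod (\<Sum>k. u k * y k z) \<le> K * cmod (N z)" by simp
    qed auto
    also have "\<dots> \<le> K * (cmod z + 1) * (cmod (N z) + 1)"
    proof -
      have "0 \<le> K" using K by linarith
      then have "0 \<le> K * cmod z" "0 \<le> K * cmod (N z)" using N by auto
      then show ?thesis by (simp add: algebra_simps del: norm_N)
    qed
    finally show ?thesis .
  qed
  define C where "C = \<bar>x0\<bar> + \<bar>y0\<bar> + l2norm (\<lambda>n. p n 0) + l2norm (\<lambda>n. q n 0) + 1"
  have pos: "0 \<le> l2norm (\<lambda>n. p n 0)" "0 \<le> l2norm (\<lambda>n. q n 0)"
    by (auto intro: l2norm_nonneg l2_p l2_q)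
  show ?thesis
  proof (rule that[of C])
    show "0 < C" using pos by (auto simp: C_def)
    show "cmod (X z) \<le> C * (cmod z + 1) * (cmod (N z) + 1)" for z
      unfolding X_def by (rule gen[OF l2_p]) (use pos in \<open>auto simp: C_def\<close>)
    show "cmod (Y z) \<le> C * (cmod z + 1) * (cmod (N z) + 1)" for z
      unfolding Y_def by (rule gen[OF l2_q]) (use pos in \<open>auto simp: C_def\<close>)
  qed
qed

lemma norm_max_modulus_bounds:
  assumes C: "0 < C" and le: "\<And>z. cmod (f z) \<le> C * (cmod z + 1) * (cmod (N z) + 1)"
  shows "locally_bounded f" "0 \<le> r \<Longrightarrow> max_modulus f r \<le> C * (r + 1) * (max_modulus N r + 1)"
proof -
  have le': "cmod (f z) \<le> C * (r + 1) * (max_modulus N r + 1)" if "cmod z \<le> r" for r z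
  proof -
    have "0 \<le> r" using that norm_ge_zero[of z] by linarith
    then have "C * (cmod z + 1) * (cmod (N z) + 1) \<le> C * (r + 1) * (max_modulus N r + 1)"
      using C that max_modulus_ge[OF locally_bounded_N that]
      by (intro mult_mono add_mono mult_left_mono) (auto simp del: norm_N)
    with le[of z] show ?thesis by linarith
  qed
  then show "locally_bounded f" unfolding locally_bounded_def by blast
  show "0 \<le> r \<Longrightarrow> max_modulus f r \<le> C * (r + 1) * (max_modulus N r + 1)"
    using le' by (intro max_modulus_le)
qed

lemma max_modulus_N_square_le:
  assumes "locally_bounded X" "locally_bounded Y" "0 \<le> r"
  shows "(max_modulus N r)\<^sup>2 \<le> 2 * (max_modulus X (r + 1) * max_modulus Y (r + 1))"
proof -
  let ?K = "max_modulus X (r + 1) * max_modulus Y (r + 1)"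
  have K: "0 \<le> ?K" using assms by (intro mult_nonneg_nonneg max_modulus_nonneg) auto
  have "max_modulus N r \<le> sqrt (2 * ?K)"
  proof (rule max_modulus_le[OF assms(3)])
    fix z assume z: "cmod z \<le> r"
    have "(l2norm (\<lambda>n. y n z))\<^sup>2 \<le> 2 ^ 1 * ?K"
    \<comment> \<open>Exponents 2 and 1 match the squared norm and the single factor
      \<open>\<bar>Im u\<bar>\<close> in \<open>Im_mult_l2norm_le\<close>.\<close>
    proof (rule l2norm_max_principle[of y 2 "r + 1" z 1])
      fix u assume u: "cmod u = r + 1"
      have "\<bar>Im u\<bar> ^ 1 * (l2norm (\<lambda>n. y n u))\<^sup>2 \<le> cmod (X u) * cmod (Y u)"
        using Im_mult_l2norm_le[of u] by simp
      also have "\<dots> \<le> ?K"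
        using u assms by (intro mult_mono max_modulus_ge max_modulus_nonneg) auto
      finally show "\<bar>Im u\<bar> ^ 1 * (l2norm (\<lambda>n. y n u))\<^sup>2 \<le> ?K" .
    qed (use z assms in \<open>auto intro: holomorphic l2_y\<close>)
    then show "cmod (N z) \<le> sqrt (2 * ?K)"
      by (simp add: real_le_rsqrt)
  qed
  then have "(max_modulus N r)\<^sup>2 \<le> (sqrt (2 * ?K))\<^sup>2"
    using assms by (intro power_mono max_modulus_nonneg locally_bounded_N)
  then show ?thesis using K by simp
qed

text \<open>Bounding \<open>g\<close> by \<open>N\<close> in the product inequality leaves
  \<open>N(r)\<^sup>2\<close> against \<open>N(r + 1) * f(r + 1)\<close>, the form that can be
  iterated. Arbitrary \<open>f\<close> and \<open>g\<close> allow \<open>X\<close> and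
  \<open>Y\<close> to exchange roles.\<close>

lemma dominated:
  assumes C: "0 < C" and f: "\<And>z. cmod (f z) \<le> C * (cmod z + 1) * (cmod (N z) + 1)"
    and g: "\<And>z. cmod (g z) \<le> C * (cmod z + 1) * (cmod (N z) + 1)"
    and sq: "\<And>r. 0 \<le> r \<Longrightarrow> (max_modulus N r)\<^sup>2 \<le> 2 * (max_modulus f (r + 1) * max_modulus g (r + 1))"
  shows "growth_dominated f N" "growth_dominated N f"
proof -
  note fb = norm_max_modulus_bounds[of C f, OF C f]
  note gb = norm_max_modulus_bounds[of C g, OF C g]
  note N0 = max_modulus_nonneg[OF locally_bounded_N]
  show "growth_dominated f N"
  proof (rule growth_dominatedI[of f N C 1])
    fix r :: real assume r: "0 \<le> r"
    have "max_modulus f r \<le> C * (r + 1) * (max_modulus N r + 1)" by (rule fb(2)[OF r])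
    also have "\<dots> \<le> C * (r + 1) * (max_modulus N (r + 1) + 1)"
      using C r by (intro mult_left_mono add_right_mono max_modulus_mono locally_bounded_N) auto
    finally show "max_modulus f r \<le> C * (r + 1) ^ 1 * (max_modulus N (r + 1) + 1)" by simp
  qed (use C N0 max_modulus_nonneg[OF fb(1)] in auto)
  obtain K where K: "\<And>r. 0 \<le> r \<Longrightarrow> max_modulus N r \<le> exp (K * (1 + r)\<^sup>2)"
    using crude_max_modulus by blast
  \<comment> \<open>A positive lower bound for \<open>max_modulus N\<close>, used to replace
    \<open>?MN + 1\<close> by a multiple of \<open>?MN\<close>. The resulting constant contains a 4:
    one 2 comes from \<open>sq\<close>, the other from
    \<open>r + 2 \<le> 2 * (r + 1)\<close>.\<close>
  define d where "d = l2norm (\<lambda>n. y n 0)"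
  have d: "0 < d" and dN: "\<And>r. 0 \<le> r \<Longrightarrow> d \<le> max_modulus N r"
    using max_modulus_N_pos by (auto simp: d_def)
  have Cd: "0 < 4 * C * (1 + 1 / d)" using C d by (auto intro!: mult_pos_pos add_pos_pos)
  show "growth_dominated N f"
  proof (rule growth_dominated_of_square_le[of N f "4 * C * (1 + 1 / d)" K 1])
    fix r :: real assume r: "0 \<le> r"
    let ?MN = "max_modulus N (r + 1)" and ?Mf = "max_modulus f (r + 1)"
    have Mf: "0 \<le> ?Mf" using r by (intro max_modulus_nonneg fb(1)) auto
    have "?MN + 1 \<le> (1 + 1 / d) * ?MN"
      using dN[of "r + 1"] r d by (simp add: field_simps)
    moreover have "r + 1 + 1 \<le> 2 * (r + 1)" using r by simp
    ultimately have "C * (r + 1 + 1) * (?MN + 1) \<le> C * (2 * (r + 1)) * ((1 + 1 / d) * ?MN)"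
      using C r d N0[of "r + 1"] by (intro mult_mono mult_left_mono) auto
    with gb(2)[of "r + 1"] r have g: "max_modulus g (r + 1) \<le> C * (2 * (r + 1)) * ((1 + 1 / d) * ?MN)"
      by linarith
    have "(max_modulus N r)\<^sup>2 \<le> 2 * (?Mf * max_modulus g (r + 1))" by (rule sq[OF r])
    also have "\<dots> \<le> 2 * (?Mf * (C * (2 * (r + 1)) * ((1 + 1 / d) * ?MN)))"
      using g Mf by (intro mult_left_mono) auto
    also have "\<dots> = 4 * C * (1 + 1 / d) * (r + 1) ^ 1 * ?MN * ?Mf" by simp
    finally show "(max_modulus N r)\<^sup>2 \<le> 4 * C * (1 + 1 / d) * (r + 1) ^ 1 * ?MN * ?Mf" .
  qed (use Cd K max_modulus_nonneg[OF fb(1)] order_less_le_trans[OF d dN] in auto)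
qed

lemma growth_dominated_XY:
  "growth_dominated X N" "growth_dominated N X" "growth_dominated Y N" "growth_dominated N Y"
proof -
  obtain C where C: "0 < C" and X: "\<And>z. cmod (X z) \<le> C * (cmod z + 1) * (cmod (N z) + 1)"
    and Y: "\<And>z. cmod (Y z) \<le> C * (cmod z + 1) * (cmod (N z) + 1)"
    using norm_XY_le by blast
  have sq: "(max_modulus N r)\<^sup>2 \<le> 2 * (max_modulus X (r + 1) * max_modulus Y (r + 1))"
    "(max_modulus N r)\<^sup>2 \<le> 2 * (max_modulus Y (r + 1) * max_modulus X (r + 1))" if "0 \<le> r" for r
    using max_modulus_N_square_le[OF norm_max_modulus_bounds(1)[OF C X] norm_max_modulus_bounds(1)[OF C Y] that]
    by (auto simp: mult.commute)
  show "growth_dominated X N" "growth_dominated N X" "growth_dominated Y N" "growth_dominated N Y"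
    using dominated[OF C X Y sq(1)] dominated[OF C Y X sq(2)] by auto
qed

end

subsection \<open>Polynomials orthonormal for a linear functional\<close>

text \<open>Quotients by a linear factor are unique; linearity of \<open>synthetic_div\<close>
  follows from this.\<close>

lemma synthetic_div_eqI:
  fixes z :: complex
  assumes "r = [:-z, 1:] * t + [:c:]"
  shows "synthetic_div r z = t"
proof -
  have "poly r z = c" by (simp add: assms)
  then have "[:-z, 1:] * synthetic_div r z = [:-z, 1:] * t"
    using synthetic_div_correct'[of z r] assms by (metis add_right_cancel)
  then show ?thesis by (simp only: mult_cancel_left) simp
qed

lemma synthetic_div_add: "synthetic_div (a + b) z = synthetic_div a z + synthetic_div b (z::complex)"
  by (rule synthetic_div_eqI[where c = "poly a z + poly b z"])
    (subst (1 2) synthetic_div_correct'[of z, symmetric], simp add: algebra_simps)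

lemma synthetic_div_smult: "synthetic_div (smult d a) z = smult d (synthetic_div a (z::complex))"
proof (rule synthetic_div_eqI[where c = "d * poly a z"])
  have "smult d a = smult d ([:-z, 1:] * synthetic_div a z + [:poly a z:])"
    by (simp only: synthetic_div_correct')
  then show "smult d a = [:-z, 1:] * smult d (synthetic_div a z) + [:d * poly a z:]"
    by (simp only: smult_add_right mult_smult_right) simp
qed

lemma synthetic_div_sum: "synthetic_div (\<Sum>k\<in>A. f k) z = (\<Sum>k\<in>A. synthetic_div (f k) (z::complex))"
  by (induction A rule: infinite_finite_induct) (auto simp: synthetic_div_add)

text \<open>The algebra of both kinds of polynomials uses only a linear functional. The form
  \<open>L (a * b)\<close> is bilinear, without conjugation, so all identities stay polynomial in
  the complex variable.\<close>

locale moment_functional =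
  fixes L :: "complex poly \<Rightarrow> complex" and p :: "nat \<Rightarrow> complex poly"
  assumes L_add: "L (a + b) = L a + L b" and L_smult: "L (smult c a) = c * L a"
    and degree_p: "degree (p n) = n"
    and orthonormal: "L (p m * p n) = of_bool (m = n)"
begin

lemma L_0 [simp]: "L 0 = 0"
  using L_smult[of 0 0] by simp

lemma L_diff: "L (a - b) = L a - L b"
  using L_add[of "a - b" b] by simp

lemma L_sum: "L (\<Sum>k\<in>A. f k) = (\<Sum>k\<in>A. L (f k))"
  by (induction A rule: infinite_finite_induct) (auto simp: L_add)

definition P where "P n z = poly (p n) z"
text \<open>As a polynomial in \<open>x\<close>, \<open>synthetic_div (p n) z\<close> is the
  difference quotient of \<open>p n\<close> between \<open>x\<close> and \<open>z\<close>; a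
  possible atom at \<open>z\<close> thus causes no trouble.\<close>

definition Q where "Q n z = L (synthetic_div (p n) z)"

lemma p_nonzero: "p n \<noteq> 0"
  using orthonormal[of n n] by auto

text \<open>Subtracting a multiple of \<open>p n\<close> removes the coefficient of degree
  \<open>n\<close>. Stating the degree bound by vanishing coefficients covers the zero polynomial
  and \<open>n = 0\<close>.\<close>

lemma span_p:
  assumes "\<And>i. n \<le> i \<Longrightarrow> coeff r i = 0"
  shows "\<exists>d. r = (\<Sum>k<n. smult (d k) (p k))"
  using assms
proof (induction n arbitrary: r)
  case 0
  then have "r = 0" by (intro poly_eqI) simp
  then show ?case by simp
next
  case (Suc n)
  define c where "c = coeff r n / coeff (p n) n"
  have lc: "coeff (p n) n \<noteq> 0" using p_nonzero[of n] degree_p[of n] by (metis leading_coeff_0_iff)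
  have "coeff (r - smult c (p n)) i = 0" if "n \<le> i" for i
  proof (cases "i = n")
    case False
    then show ?thesis using that Suc.prems[of i] degree_p[of n] by (simp add: coeff_eq_0)
  qed (use lc in \<open>simp add: c_def\<close>)
  then obtain d where d: "r - smult c (p n) = (\<Sum>k<n. smult (d k) (p k))"
    using Suc.IH by blast
  have "r = (\<Sum>k<Suc n. smult ((d(n := c)) k) (p k))"
    using d by (simp add: diff_eq_eq)
  then show ?case by blast
qed

lemma expand_p:
  assumes "\<And>i. n \<le> i \<Longrightarrow> coeff r i = 0"
  shows "r = (\<Sum>k<n. smult (L (r * p k)) (p k))"
proof -
  obtain d where d: "r = (\<Sum>k<n. smult (d k) (p k))" using span_p[OF assms] by blast
  have "L (r * p j) = d j" if "j < n" for j
  proof -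
    have "L (r * p j) = (\<Sum>k<n. d k * of_bool (k = j))"
      by (subst d) (simp add: sum_distrib_right L_sum L_smult orthonormal)
    also have "\<dots> = d j" using that by simp
    finally show ?thesis .
  qed
  then show ?thesis by (subst d) simp
qed

lemma orthogonal:
  assumes "\<And>i. n \<le> i \<Longrightarrow> coeff r i = 0"
  shows "L (p n * r) = 0"
proof -
  have "L (p n * r) = (\<Sum>k<n. L (r * p k) * L (p n * p k))"
    by (subst expand_p[OF assms]) (simp_all add: sum_distrib_left L_sum L_smult)
  also have "\<dots> = 0" by (simp add: orthonormal)
  finally show ?thesis .
qed

lemma coeff_synthetic_div_p: "n \<le> i \<Longrightarrow> coeff (synthetic_div (p n) w) i = 0"
proof (cases "n = 0")
  case True
  then have "synthetic_div (p n) w = 0" using degree_p[of n] by (simp add: synthetic_div_eq_0_iff)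
  then show ?thesis by simp
next
  case False
  moreover assume "n \<le> i"
  ultimately show ?thesis
    by (intro coeff_eq_0) (simp add: degree_synthetic_div degree_p)
qed

text \<open>Multiplying out \<open>p k\<close> around \<open>w\<close> moves the linear factor from
  \<open>synthetic_div (p k) w\<close> to \<open>synthetic_div (p n) w\<close>, where it restores
  \<open>p n\<close> minus a constant. The product with \<open>p n\<close> vanishes under
  \<open>L\<close> by orthogonality.\<close>

lemma kernel:
  assumes "k < n"
  shows "L (synthetic_div (p n) w * p k) = Q n w * P k w - P n w * Q k w"
proof -
  let ?S = "\<lambda>n. synthetic_div (p n) w"
  have pk: "p k = [:-w, 1:] * ?S k + [:poly (p k) w:]" for k
    by (simp only: synthetic_div_correct')
  have "?S n * p k = ([:-w, 1:] * ?S n) * ?S k + smult (poly (p k) w) (?S n)"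
    by (subst pk[of k]) (simp add: algebra_simps)
  also have "[:-w, 1:] * ?S n = p n - [:poly (p n) w:]"
    using pk[of n] by (simp add: algebra_simps)
  finally have "L (?S n * p k) = L (p n * ?S k) - P n w * Q k w + P k w * Q n w"
    by (simp add: left_diff_distrib L_add L_diff L_smult P_def Q_def)
  also have "L (p n * ?S k) = 0"
    using assms by (intro orthogonal coeff_synthetic_div_p) auto
  finally show ?thesis by simp
qed

lemma synthetic_div_p: "synthetic_div (p n) w = (\<Sum>k<n. smult (Q n w * P k w - P n w * Q k w) (p k))"
  by (subst expand_p[OF coeff_synthetic_div_p]) (auto simp: kernel)

text \<open>The difference quotient at \<open>w\<close> is expanded in the orthonormal basis and
  evaluated at \<open>z\<close>.\<close>

lemma P_recurrence: "P n z = P n w + (z - w) * (\<Sum>k<n. (Q n w * P k w - P n w * Q k w) * P k z)"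
proof -
  have "P n z = poly ([:-w, 1:] * synthetic_div (p n) w + [:poly (p n) w:]) z"
    by (simp only: synthetic_div_correct' P_def)
  also have "\<dots> = P n w + (z - w) * poly (synthetic_div (p n) w) z"
    by (simp add: P_def algebra_simps)
  also have "poly (synthetic_div (p n) w) z = (\<Sum>k<n. (Q n w * P k w - P n w * Q k w) * P k z)"
    by (simp add: synthetic_div_p poly_sum P_def[of _ z])
  finally show ?thesis .
qed

text \<open>The quotients at \<open>z\<close> and at \<open>w\<close> differ by \<open>z - w\<close>
  times a second-order quotient, and \<open>L\<close> sends the expansion of the latter to a
  combination of the \<open>Q k z\<close>.\<close>

lemma Q_recurrence: "Q n z = Q n w + (z - w) * (\<Sum>k<n. (Q n w * P k w - P n w * Q k w) * Q k z)"
proof -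
  let ?S = "synthetic_div (p n) w"
  have "p n = [:-w, 1:] * ?S + [:poly (p n) w:]"
    by (simp only: synthetic_div_correct')
  also have "\<dots> = [:-z, 1:] * ?S + smult (z - w) ?S + [:poly (p n) w:]"
    by (simp add: smult_diff_left algebra_simps)
  also have "\<dots> = [:-z, 1:] * ?S + smult (z - w) ([:-z, 1:] * synthetic_div ?S z + [:poly ?S z:]) + [:poly (p n) w:]"
    by (simp only: synthetic_div_correct')
  also have "\<dots> = [:-z, 1:] * (?S + smult (z - w) (synthetic_div ?S z)) + [:(z - w) * poly ?S z + poly (p n) w:]"
    by (simp only: smult_add_right distrib_left mult_smult_right) (simp add: algebra_simps)
  finally have "synthetic_div (p n) z = ?S + smult (z - w) (synthetic_div ?S z)"
    by (rule synthetic_div_eqI)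
  then have "Q n z = Q n w + (z - w) * L (synthetic_div ?S z)"
    by (simp add: Q_def L_add L_smult)
  also have "L (synthetic_div ?S z) = (\<Sum>k<n. (Q n w * P k w - P n w * Q k w) * Q k z)"
    by (simp add: synthetic_div_p[of n w] synthetic_div_sum synthetic_div_smult L_sum L_smult Q_def[of _ z])
  finally show ?thesis .
qed

lemma L_1_eq: "L 1 * (P 0 0)\<^sup>2 = 1"
proof -
  obtain c where c: "p 0 = [:c:]" using degree_p[of 0] by (metis degree_eq_zeroE)
  have "p 0 * p 0 = smult (c\<^sup>2) 1" by (simp add: c power2_eq_square)
  then have "L (p 0 * p 0) = L 1 * (P 0 0)\<^sup>2"
    by (simp only: L_smult) (simp add: P_def c)
  then show ?thesis using orthonormal[of 0 0] by simp
qed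

text \<open>The quotient of a linear polynomial is its leading coefficient. Index 1 is used because
  \<open>Q 0\<close> vanishes identically.\<close>

lemma Q_1_nonzero: "Q 1 0 \<noteq> 0"
proof -
  obtain a b where ab: "p 1 = [:b, a:]" "a \<noteq> 0"
  proof -
    obtain b r where r: "p 1 = pCons b r" by (cases "p 1")
    with degree_p[of 1] have "degree r = 0" "r \<noteq> 0" by (auto split: if_splits)
    then show ?thesis using that r by (metis degree_eq_zeroE pCons_eq_0_iff)
  qed
  then have "synthetic_div (p 1) 0 = smult a 1" by simp
  then have "Q 1 0 = a * L 1" by (simp only: Q_def L_smult)
  then show ?thesis using ab L_1_eq by auto
qed

end

subsection \<open>The Stieltjes transform\<close>

lemma has_moments_real_distribution:
  assumes "has_moments \<nu> s" "s 0 = 1"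
  shows "real_distribution \<nu>"
proof -
  from assms have sets: "sets \<nu> = sets borel" and "has_bochner_integral \<nu> (\<lambda>x. x ^ 0) (s 0)"
    unfolding has_moments_def by (blast, blast)
  then have i: "integrable \<nu> (\<lambda>x. 1::real)" and e: "integral\<^sup>L \<nu> (\<lambda>x. 1::real) = 1"
    using assms(2) by (simp_all add: has_bochner_integral_iff)
  have "emeasure \<nu> (space \<nu>) \<noteq> \<infinity>" using i by (simp add: integrable_iff_bounded less_top)
  moreover have "measure \<nu> (space \<nu>) = 1" using e by simp
  ultimately have "emeasure \<nu> (space \<nu>) = 1" by (simp add: emeasure_eq_ennreal_measure)
  then interpret prob_space \<nu> by (rule prob_spaceI)
  show ?thesis
    by unfold_locales (use sets sets_eq_imp_space_eq[OF sets] in auto)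
qed

text \<open>With this sign the imaginary part is positive in the upper half-plane, where it is an
  integral of the Poisson kernel up to a factor of \<pi>.\<close>

definition stieltjes :: "real measure \<Rightarrow> complex \<Rightarrow> complex" where
  "stieltjes \<nu> z = (\<integral>x. 1 / (of_real x - z) \<partial>\<nu>)"

lemma norm_resolvent_le:
  assumes "Im z \<noteq> 0"
  shows "cmod (1 / (of_real x - z)) \<le> 1 / \<bar>Im z\<bar>"
proof -
  have "\<bar>Im z\<bar> \<le> cmod (of_real x - z)" using abs_Im_le_cmod[of "of_real x - z"] by simp
  then show ?thesis using assms by (simp add: norm_divide divide_left_mono frac_le)
qed

lemma Im_resolvent: "Im (1 / (complex_of_real x - Complex t y)) = y / (y\<^sup>2 + (t - x)\<^sup>2)"
  by (simp add: Im_divide power2_eq_square algebra_simps)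

section \<open>Integrals of the resolvent and inversion\<close>

context real_distribution
begin

lemma integrable_resolvent:
  assumes "Im z \<noteq> 0"
  shows "integrable M (\<lambda>x. 1 / (complex_of_real x - z))"
  by (rule integrable_const_bound[of _ "1 / \<bar>Im z\<bar>"])
    (use norm_resolvent_le[OF assms] in \<open>auto simp: measurable_cong_sets[OF events_eq_borel refl]\<close>)

lemma norm_stieltjes_le:
  assumes "Im z \<noteq> 0"
  shows "cmod (stieltjes M z) \<le> 1 / \<bar>Im z\<bar>"
proof -
  have "cmod (stieltjes M z) \<le> (\<integral>x. 1 / \<bar>Im z\<bar> \<partial>M)"
    unfolding stieltjes_def
    by (rule order_trans[OF integral_norm_bound integral_mono])
      (use norm_resolvent_le[OF assms] integrable_norm[OF integrable_resolvent[OF assms]] in auto)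
  then show ?thesis using prob_space by simp
qed

lemma Im_stieltjes:
  assumes "y \<noteq> 0"
  shows "integrable M (\<lambda>x. y / (y\<^sup>2 + (t - x)\<^sup>2))"
    and "Im (stieltjes M (Complex t y)) = (\<integral>x. y / (y\<^sup>2 + (t - x)\<^sup>2) \<partial>M)"
proof -
  have i: "integrable M (\<lambda>x. 1 / (complex_of_real x - Complex t y))"
    using assms by (intro integrable_resolvent) simp
  show "integrable M (\<lambda>x. y / (y\<^sup>2 + (t - x)\<^sup>2))"
    using integrable_Im[OF i] by (simp only: Im_resolvent)
  show "Im (stieltjes M (Complex t y)) = (\<integral>x. y / (y\<^sup>2 + (t - x)\<^sup>2) \<partial>M)"
    using integral_Im[OF i] by (simp only: Im_resolvent stieltjes_def)
qed

text \<open>Stieltjes inversion, in the form needed for uniqueness: the integrated Poisson kernel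
  \<open>arctan\<close> is a function of the Stieltjes transform only.\<close>

lemma nn_integral_arctan:
  assumes "0 < y" "a \<le> b"
  shows "(\<integral>\<^sup>+x. ennreal (arctan ((b - x) / y) - arctan ((a - x) / y)) \<partial>M)
    = (\<integral>\<^sup>+t. ennreal (Im (stieltjes M (Complex t y))) * indicator {a..b} t \<partial>lborel)"
proof -
  interpret pair_sigma_finite lborel M ..
  have [measurable_cong]: "sets M = sets borel" by (rule events_eq_borel)
  let ?k = "\<lambda>t x. ennreal (y / (y\<^sup>2 + (t - x)\<^sup>2)) * indicator {a..b} t"
  have pos: "0 < y\<^sup>2 + u\<^sup>2" for u using assms by (simp add: add_pos_nonneg)
  have "(\<integral>\<^sup>+x. \<integral>\<^sup>+t. ?k t x \<partial>lborel \<partial>M) = (\<integral>\<^sup>+t. \<integral>\<^sup>+x. ?k t x \<partial>M \<partial>lborel)"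
    by (rule Fubini') measurable
  moreover have "(\<integral>\<^sup>+t. ?k t x \<partial>lborel) = ennreal (arctan ((b - x) / y) - arctan ((a - x) / y))" for x
  proof (rule nn_integral_FTC_Icc)
    fix t
    have "((\<lambda>t. arctan ((t - x) / y)) has_real_derivative inverse (1 + ((t - x) / y)\<^sup>2) * (1 / y)) (at t)"
      using assms by (intro DERIV_chain2[OF DERIV_arctan]) (auto intro!: derivative_eq_intros)
    also have "inverse (1 + ((t - x) / y)\<^sup>2) * (1 / y) = y / (y\<^sup>2 + (t - x)\<^sup>2)"
    proof -
      have "1 + ((t - x) / y)\<^sup>2 = (y\<^sup>2 + (t - x)\<^sup>2) / y\<^sup>2"
        using assms by (simp add: add_divide_distrib power_divide)
      then show ?thesis using assms by (simp add: power2_eq_square)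
    qed
    finally show "((\<lambda>t. arctan ((t - x) / y)) has_real_derivative y / (y\<^sup>2 + (t - x)\<^sup>2)) (at t)" .
    show "0 \<le> y / (y\<^sup>2 + (t - x)\<^sup>2)" using assms pos[of "t - x"] by simp
  qed (use assms in auto)
  moreover have "(\<integral>\<^sup>+x. ?k t x \<partial>M) = ennreal (Im (stieltjes M (Complex t y))) * indicator {a..b} t" for t
  proof -
    have "(\<integral>\<^sup>+x. ennreal (y / (y\<^sup>2 + (t - x)\<^sup>2)) \<partial>M) = ennreal (\<integral>x. y / (y\<^sup>2 + (t - x)\<^sup>2) \<partial>M)"
    proof (rule nn_integral_eq_integral)
      show "integrable M (\<lambda>x. y / (y\<^sup>2 + (t - x)\<^sup>2))" using assms by (intro Im_stieltjes) simp
      show "AE x in M. 0 \<le> y / (y\<^sup>2 + (t - x)\<^sup>2)" using assms by simp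
    qed
    also have "\<dots> = ennreal (Im (stieltjes M (Complex t y)))"
      using assms by (subst Im_stieltjes(2)) simp_all
    finally show ?thesis by (simp add: nn_integral_multc)
  qed
  ultimately show ?thesis by simp
qed

text \<open>The width \<open>1 / real (Suc n) ^ 2\<close> shrinks faster than the offset
  \<open>1 / real (Suc n)\<close> of the upper endpoint. A possible atom at \<open>b\<close> is
  therefore counted in full, as the right-continuous \<open>cdf\<close> requires, and the lower
  endpoint runs off to minus infinity.\<close>

lemma cdf_eq_lim_arctan:
  fixes b :: real
  defines "f \<equiv> \<lambda>n x. arctan ((b + 1 / real (Suc n) - x) / (1 / real (Suc n) ^ 2)) - arctan ((- real n + b - x) / (1 / real (Suc n) ^ 2))"
  shows "(\<lambda>n. integral\<^sup>L M (f n)) \<longlonglongrightarrow> pi * cdf M b"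
proof -
  have [measurable_cong]: "sets M = sets borel" by (rule events_eq_borel)
  have "(\<lambda>n. integral\<^sup>L M (f n)) \<longlonglongrightarrow> (\<integral>x. pi * indicator {..b} x \<partial>M)"
  proof (rule integral_dominated_convergence[where w = "\<lambda>x. pi"])
    show "AE x in M. norm (f n x) \<le> pi" for n
    proof (rule AE_I2)
      fix x
      have "\<bar>arctan u - arctan v\<bar> \<le> pi" for u v
        using arctan_bounded[of u] arctan_bounded[of v] by (auto simp: abs_le_iff)
      then show "norm (f n x) \<le> pi" by (simp add: f_def)
    qed
    show "AE x in M. (\<lambda>n. f n x) \<longlonglongrightarrow> pi * indicator {..b} x"
    proof (rule AE_I2)
      fix x
      have neg: "(\<lambda>n. arctan ((- real n + b - x) / (1 / real (Suc n) ^ 2))) \<longlonglongrightarrow> - (pi / 2)"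
        by (rule filterlim_compose[OF tendsto_arctan_at_bot]) real_asymp
      show "(\<lambda>n. f n x) \<longlonglongrightarrow> pi * indicator {..b} x"
      proof (cases "x \<le> b")
        case True
        have "filterlim (\<lambda>n. (d + 1 / real (Suc n)) / (1 / real (Suc n) ^ 2)) at_top sequentially" if "0 \<le> d" for d
        proof (cases "d = 0")
          case True
          show ?thesis unfolding True by real_asymp
        next
          case False
          with that have "0 < d" by simp
          then show ?thesis by real_asymp
        qed
        from this[of "b - x"] True
        have "(\<lambda>n. arctan ((b + 1 / real (Suc n) - x) / (1 / real (Suc n) ^ 2))) \<longlonglongrightarrow> pi / 2"
          by (intro filterlim_compose[OF tendsto_arctan_at_top]) (simp add: algebra_simps)
        from tendsto_diff[OF this neg] show ?thesis using True by (simp add: f_def)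
      next
        case False
        then have "0 < x - b" by simp
        then have "filterlim (\<lambda>n. (- (x - b) + 1 / real (Suc n)) / (1 / real (Suc n) ^ 2)) at_bot sequentially"
          by real_asymp
        then have "(\<lambda>n. arctan ((b + 1 / real (Suc n) - x) / (1 / real (Suc n) ^ 2))) \<longlonglongrightarrow> - (pi / 2)"
          by (intro filterlim_compose[OF tendsto_arctan_at_bot]) (simp add: algebra_simps)
        from tendsto_diff[OF this neg] show ?thesis using False by (simp add: f_def)
      qed
    qed
  qed (auto simp: f_def)
  then show ?thesis by (simp add: cdf_def measurable_cong_sets)
qed

end

lemma stieltjes_unique:
  assumes "real_distribution \<mu>" "real_distribution \<nu>"
    and eq: "\<And>z. Im z \<noteq> 0 \<Longrightarrow> stieltjes \<mu> z = stieltjes \<nu> z"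
  shows "\<mu> = \<nu>"
proof -
  interpret \<mu>: real_distribution \<mu> by fact
  interpret \<nu>: real_distribution \<nu> by fact
  have int: "(\<integral>x. arctan ((b - x) / y) - arctan ((a - x) / y) \<partial>\<mu>) = (\<integral>x. arctan ((b - x) / y) - arctan ((a - x) / y) \<partial>\<nu>)"
    if "0 < y" "a \<le> b" for a b y :: real
  proof -
    have [simp]: "(\<lambda>x. arctan ((b - x) / y) - arctan ((a - x) / y)) \<in> borel_measurable borel" by measurable
    have pos: "0 \<le> arctan ((b - x) / y) - arctan ((a - x) / y)" for x
      using arctan_monotone'[of "(a - x) / y" "(b - x) / y"] that by (simp add: divide_right_mono)
    have "integral\<^sup>L M (\<lambda>x. arctan ((b - x) / y) - arctan ((a - x) / y))
        = enn2real (\<integral>\<^sup>+t. ennreal (Im (stieltjes M (Complex t y))) * indicator {a..b} t \<partial>lborel)"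
      if M: "real_distribution M" for M
    proof -
      have "(\<lambda>x. arctan ((b - x) / y) - arctan ((a - x) / y)) \<in> borel_measurable M"
        using real_distribution.events_eq_borel[OF M] by (subst measurable_cong_sets[OF _ refl]) auto
      then show ?thesis
        unfolding real_distribution.nn_integral_arctan[OF M \<open>0 < y\<close> \<open>a \<le> b\<close>, symmetric]
        by (rule integral_eq_nn_integral) (rule AE_I2[OF pos])
    qed
    from this[OF assms(1)] this[OF assms(2)] show ?thesis
      using that by (simp add: eq)
  qed
  have "cdf \<mu> = cdf \<nu>"
  proof
    fix b
    have *: "(\<integral>x. arctan ((b + 1 / real (Suc n) - x) / (1 / real (Suc n) ^ 2))
        - arctan ((- real n + b - x) / (1 / real (Suc n) ^ 2)) \<partial>\<nu>)
      = (\<integral>x. arctan ((b + 1 / real (Suc n) - x) / (1 / real (Suc n) ^ 2))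
        - arctan ((- real n + b - x) / (1 / real (Suc n) ^ 2)) \<partial>\<mu>)" for n
    proof (rule int[symmetric])
      have "- real n + b \<le> b" and "0 \<le> 1 / real (Suc n)" by simp_all
      then show "- real n + b \<le> b + 1 / real (Suc n)" by linarith
    qed simp
    have "(\<lambda>n. (\<integral>x. arctan ((b + 1 / real (Suc n) - x) / (1 / real (Suc n) ^ 2))
        - arctan ((- real n + b - x) / (1 / real (Suc n) ^ 2)) \<partial>\<mu>)) \<longlonglongrightarrow> pi * cdf \<nu> b"
      using \<nu>.cdf_eq_lim_arctan[of b] unfolding * .
    with \<mu>.cdf_eq_lim_arctan[of b] have "pi * cdf \<mu> b = pi * cdf \<nu> b"
      by (rule LIMSEQ_unique)
    then show "cdf \<mu> b = cdf \<nu> b" by simp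
  qed
  then show ?thesis using assms by (intro cdf_unique)
qed

subsection \<open>Hamburger moment problems\<close>

locale hamburger_problem =
  fixes \<mu> :: "real measure" and s :: "nat \<Rightarrow> real" and p :: "nat \<Rightarrow> real poly"
  assumes prob: "prob_space \<mu>" and moments: "has_moments \<mu> s" and orthonormal_polys: "orthonormal_polys \<mu> p"
begin

lemma s_0: "s 0 = 1"
proof -
  interpret prob_space \<mu> by (rule prob)
  have "has_bochner_integral \<mu> (\<lambda>x. x ^ 0) (s 0)"
    using moments unfolding has_moments_def by blast
  then have "s 0 = integral\<^sup>L \<mu> (\<lambda>x. 1)" by (simp add: has_bochner_integral_iff)
  then show ?thesis using prob_space by simp
qed

text \<open>Defined by the moments alone, so that \<open>L\<close> is integration against every
  solution of the moment problem and not just against \<mu>.\<close>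

definition L :: "complex poly \<Rightarrow> complex" where
  "L r = (\<Sum>i\<le>degree r. coeff r i * of_real (s i))"

lemma has_bochner_integral_poly:
  assumes "has_moments \<nu> s"
  shows "has_bochner_integral \<nu> (\<lambda>x. poly r (complex_of_real x)) (L r)"
proof -
  have "has_bochner_integral \<nu> (\<lambda>x. coeff r i * complex_of_real x ^ i) (coeff r i * of_real (s i))" for i
    using assms unfolding has_moments_def of_real_power[symmetric]
    by (intro has_bochner_integral_mult_right has_bochner_integral_of_real) auto
  then show ?thesis unfolding poly_altdef L_def by (intro has_bochner_integral_sum)
qed

lemma L_eq_integral: "L r = (\<integral>x. poly r (of_real x) \<partial>\<mu>)"
  using has_bochner_integral_poly[OF moments, of r] by (simp add: has_bochner_integral_iff)

definition cp :: "nat \<Rightarrow> complex poly" where "cp n = map_poly of_real (p n)"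

lemma poly_cp_of_real: "poly (cp n) (of_real x) = of_real (poly (p n) x)"
  by (simp add: cp_def poly_altdef degree_map_poly coeff_map_poly)

sublocale moment_functional L cp
proof
  show "L (a + b) = L a + L b" for a b
    using has_bochner_integral_add[OF has_bochner_integral_poly[OF moments, of a] has_bochner_integral_poly[OF moments, of b]]
    by (simp add: L_eq_integral has_bochner_integral_iff)
  show "L (smult c a) = c * L a" for c a
    by (simp add: L_eq_integral)
  show "degree (cp n) = n" for n
    using orthonormal_polys by (simp add: cp_def orthonormal_polys_def degree_map_poly)
  show "L (cp m * cp n) = of_bool (m = n)" for m n
  proof -
    have "L (cp m * cp n) = (\<integral>x. complex_of_real (poly (p m) x * poly (p n) x) \<partial>\<mu>)"
      by (simp add: L_eq_integral poly_cp_of_real)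
    also have "\<dots> = of_real (\<integral>x. poly (p m) x * poly (p n) x \<partial>\<mu>)"
      by (rule integral_complex_of_real)
    also have "\<dots> = of_bool (m = n)"
      using orthonormal_polys by (simp add: orthonormal_polys_def)
    finally show ?thesis .
  qed
qed

lemma first_kind_eq: "first_kind p n z = P n z"
  by (simp add: first_kind_def P_def cp_def)

lemma second_kind_eq: "second_kind \<mu> p n z = Q n z"
proof -
  \<comment> \<open>At \<open>x = z\<close> the difference quotient polynomial takes the value of
    the derivative, which is the value prescribed in \<open>second_kind\<close>.\<close>
  have "(if complex_of_real x = z then poly (pderiv (cp n)) z
      else (P n z - P n (of_real x)) / (z - of_real x)) = poly (synthetic_div (cp n) z) (of_real x)" for x
  proof (cases "complex_of_real x = z")
    case True
    have "pderiv (cp n) = pderiv ([:-z, 1:] * synthetic_div (cp n) z + [:poly (cp n) z:])"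
      by (simp only: synthetic_div_correct')
    also have "poly \<dots> z = poly (synthetic_div (cp n) z) z"
      by (simp add: pderiv_mult pderiv_add pderiv_diff pderiv_smult pderiv_pCons)
    finally show ?thesis using True by simp
  next
    case False
    have "P n (of_real x) = poly ([:-z, 1:] * synthetic_div (cp n) z + [:poly (cp n) z:]) (of_real x)"
      by (simp only: synthetic_div_correct' P_def)
    then have "P n z - P n (of_real x) = (z - of_real x) * poly (synthetic_div (cp n) z) (of_real x)"
      by (simp add: P_def algebra_simps)
    then show ?thesis using False by simp
  qed
  then show ?thesis
    unfolding second_kind_def first_kind_eq Q_def L_eq_integral cp_def[symmetric] by (simp only:)
qed

lemma cnj_P: "P n (cnj z) = cnj (P n z)"
  by (simp add: P_def cp_def poly_altdef degree_map_poly coeff_map_poly)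

lemma cnj_Q: "Q n (cnj z) = cnj (Q n z)"
proof -
  have pd: "poly (pderiv (cp n)) (cnj z) = cnj (poly (pderiv (cp n)) z)"
    by (simp add: poly_altdef cp_def degree_pderiv degree_map_poly coeff_pderiv coeff_map_poly)
  have "second_kind \<mu> p n (cnj z) = cnj (second_kind \<mu> p n z)"
    unfolding second_kind_def Bochner_Integration.integral_cnj[symmetric]
  proof (rule Bochner_Integration.integral_cong[OF refl])
    fix x
    have "complex_of_real x = cnj z \<longleftrightarrow> complex_of_real x = z"
      by (metis complex_cnj_cnj complex_cnj_complex_of_real)
    moreover have "P n (of_real x) = cnj (P n (of_real x))"
      using cnj_P[of n "of_real x"] by simp
    ultimately show "(if complex_of_real x = cnj z then poly (pderiv (map_poly complex_of_real (p n))) (cnj z)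
         else (first_kind p n (cnj z) - first_kind p n (complex_of_real x)) / (cnj z - complex_of_real x)) =
        cnj (if complex_of_real x = z then poly (pderiv (map_poly complex_of_real (p n))) z
         else (first_kind p n z - first_kind p n (complex_of_real x)) / (z - complex_of_real x))"
      using pd by (simp add: first_kind_eq cnj_P cp_def[symmetric])
  qed
  then show ?thesis by (simp add: second_kind_eq)
qed

text \<open>Bessel's inequality for the function \<open>1 / (x - z)\<close>, whose Fourier coefficients are the left-hand sides.\<close>

lemma bessel:
  assumes \<nu>: "has_moments \<nu> s" and z: "Im z \<noteq> 0"
  shows "l2 (\<lambda>n. stieltjes \<nu> z * P n z + Q n z)"
    and "l2norm (\<lambda>n. stieltjes \<nu> z * P n z + Q n z) \<le> 1 / \<bar>Im z\<bar>"
proof -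
  interpret real_distribution \<nu> using \<nu> s_0 by (rule has_moments_real_distribution)
  define h where "h n = stieltjes \<nu> z * P n z + Q n z" for n
  define u where "u x = 1 / (complex_of_real x - z)" for x
  have [measurable]: "u \<in> borel_measurable borel" unfolding u_def by measurable
  have iu: "has_bochner_integral \<nu> u (stieltjes \<nu> z)"
    using integrable_resolvent[OF z] by (simp add: has_bochner_integral_iff stieltjes_def u_def[abs_def])
  have iuP: "has_bochner_integral \<nu> (\<lambda>x. u x * P n (of_real x)) (h n)" for n
  proof -
    have nz: "complex_of_real x - z \<noteq> 0" for x using z by (auto simp: complex_eq_iff)
    have "u x * P n (of_real x) = u x * P n z + poly (synthetic_div (cp n) z) (of_real x)" for x
    proof -
      have "P n (of_real x) = poly ([:-z, 1:] * synthetic_div (cp n) z + [:poly (cp n) z:]) (of_real x)"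
        by (simp only: synthetic_div_correct' P_def)
      then have "P n (of_real x) = P n z + (of_real x - z) * poly (synthetic_div (cp n) z) (of_real x)"
        by (simp add: P_def algebra_simps)
      then show ?thesis using nz[of x] by (simp add: u_def distrib_left)
    qed
    then show ?thesis
      unfolding h_def Q_def
      using has_bochner_integral_add[OF has_bochner_integral_mult_left[OF iu, of "P n z"] has_bochner_integral_poly[OF \<nu>, of "synthetic_div (cp n) z"]]
      by simp
  qed
  have iPP: "has_bochner_integral \<nu> (\<lambda>x. P m (of_real x) * P n (of_real x)) (of_bool (m = n))" for m n
    using has_bochner_integral_poly[OF \<nu>, of "cp m * cp n"] by (simp add: P_def orthonormal)
  have real: "cnj (P n (of_real x)) = P n (of_real x)" for n x
    using cnj_P[of n "of_real x"] by simp
  have "(L2_set (\<lambda>n. cmod (h n)) {..<N})\<^sup>2 \<le> (1 / \<bar>Im z\<bar>)\<^sup>2" for N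
  proof -
    \<comment> \<open>\<open>H\<close> is the sum of the squared moduli of the coefficients. It
      occurs as the inner product of \<open>u\<close> with its partial expansion \<open>v\<close>
      and as the squared norm of \<open>v\<close>.\<close>
    define H where "H = (\<Sum>n<N. h n * cnj (h n))"
    define v where "v x = (\<Sum>n<N. h n * P n (of_real x))" for x
    have cv: "cnj (v x) = (\<Sum>n<N. cnj (h n) * P n (of_real x))" for x
      by (simp add: v_def real)
    have 1: "has_bochner_integral \<nu> (\<lambda>x. u x * cnj (v x)) H"
    proof -
      have "has_bochner_integral \<nu> (\<lambda>x. \<Sum>n<N. cnj (h n) * (u x * P n (of_real x))) (\<Sum>n<N. cnj (h n) * h n)"
        by (intro has_bochner_integral_sum has_bochner_integral_mult_right iuP)
      then show ?thesis by (simp add: cv H_def sum_distrib_left mult_ac)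
    qed
    have 2: "has_bochner_integral \<nu> (\<lambda>x. cnj (u x) * v x) (cnj H)"
      using has_bochner_integral_cnj[OF 1] by simp
    have 3: "has_bochner_integral \<nu> (\<lambda>x. v x * cnj (v x)) H"
    proof -
      have "has_bochner_integral \<nu> (\<lambda>x. \<Sum>n<N. \<Sum>m<N. (h n * cnj (h m)) * (P n (of_real x) * P m (of_real x)))
         (\<Sum>n<N. \<Sum>m<N. (h n * cnj (h m)) * of_bool (n = m))"
        by (intro has_bochner_integral_sum has_bochner_integral_mult_right iPP)
      moreover have "(\<Sum>n<N. \<Sum>m<N. (h n * cnj (h m)) * of_bool (n = m)) = H"
        unfolding H_def by (intro sum.cong refl) simp
      moreover have "v x * cnj (v x) = (\<Sum>n<N. \<Sum>m<N. (h n * cnj (h m)) * (P n (of_real x) * P m (of_real x)))" for x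
        unfolding cv unfolding v_def sum_product by (simp add: mult_ac)
      ultimately show ?thesis by simp
    qed
    have nu: "cmod (u x * cnj (u x)) \<le> (1 / \<bar>Im z\<bar>)\<^sup>2" for x
      using power_mono[OF norm_resolvent_le[OF z, of x] norm_ge_zero, of 2]
      by (simp only: norm_mult complex_mod_cnj u_def power2_eq_square)
    have "cnj \<in> borel_measurable borel"
      by (intro borel_measurable_continuous_onI continuous_intros)
    then have uu: "(\<lambda>x. u x * cnj (u x)) \<in> borel_measurable borel"
      by measurable
    have int_uu: "integrable \<nu> (\<lambda>x. u x * cnj (u x))"
      by (rule integrable_const_bound[of _ "(1 / \<bar>Im z\<bar>)\<^sup>2"])
        (use nu uu in \<open>auto simp: measurable_cong_sets[OF events_eq_borel refl]\<close>)
    define U where "U = (\<integral>x. u x * cnj (u x) \<partial>\<nu>)"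
    have 4: "has_bochner_integral \<nu> (\<lambda>x. u x * cnj (u x)) U"
      using int_uu by (simp add: has_bochner_integral_iff U_def)
    have "cmod U \<le> (\<integral>x. (1 / \<bar>Im z\<bar>)\<^sup>2 \<partial>\<nu>)"
      unfolding U_def
      by (rule order_trans[OF integral_norm_bound integral_mono]) (use nu int_uu in auto)
    then have U: "cmod U \<le> (1 / \<bar>Im z\<bar>)\<^sup>2" using prob_space by simp
    have "has_bochner_integral \<nu> (\<lambda>x. u x * cnj (u x) - u x * cnj (v x) - cnj (u x) * v x + v x * cnj (v x))
        (U - H - cnj H + H)"
      by (intro has_bochner_integral_add has_bochner_integral_diff 1 2 3 4)
    moreover have "u x * cnj (u x) - u x * cnj (v x) - cnj (u x) * v x + v x * cnj (v x)
        = of_real ((cmod (u x - v x))\<^sup>2)" for x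
      by (simp only: complex_norm_square) (simp add: algebra_simps)
    ultimately have "has_bochner_integral \<nu> (\<lambda>x. complex_of_real ((cmod (u x - v x))\<^sup>2)) (U - cnj H)"
      by simp
    then have "has_bochner_integral \<nu> (\<lambda>x. Re (complex_of_real ((cmod (u x - v x))\<^sup>2))) (Re (U - cnj H))"
      by (rule has_bochner_integral_Re)
    then have "Re (U - cnj H) = (\<integral>x. (cmod (u x - v x))\<^sup>2 \<partial>\<nu>)"
      by (simp add: has_bochner_integral_iff)
    then have "0 \<le> Re (U - cnj H)" by simp
    \<comment> \<open>\<open>H\<close> is real, so the nonnegative integral of
      \<open>(cmod (u x - v x))\<^sup>2\<close> equals \<open>Re U - H\<close>.\<close>
    moreover have "H = of_real ((L2_set (\<lambda>n. cmod (h n)) {..<N})\<^sup>2)"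
      unfolding H_def L2_set_def complex_norm_square[symmetric] by (simp add: sum_nonneg)
    ultimately have "(L2_set (\<lambda>n. cmod (h n)) {..<N})\<^sup>2 \<le> Re U" by simp
    then show ?thesis using complex_Re_le_cmod[of U] U by linarith
  qed
  then have "L2_set (\<lambda>n. cmod (h n)) {..<N} \<le> 1 / \<bar>Im z\<bar>" for N
    by (rule power2_le_imp_le) simp
  from l2_of_L2_set_le[OF this] show "l2 (\<lambda>n. stieltjes \<nu> z * P n z + Q n z)"
    "l2norm (\<lambda>n. stieltjes \<nu> z * P n z + Q n z) \<le> 1 / \<bar>Im z\<bar>"
    by (auto simp: h_def)
qed

text \<open>Subtracting the Bessel sequences of two solutions at the same \<open>z\<close> cancels
  \<open>Q n z\<close> and leaves a nonzero multiple of \<open>P n z\<close>. One of the sequences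
  then yields \<open>Q n z\<close>.\<close>

lemma l2_of_indeterminate:
  assumes "indeterminate s"
  obtains z where "l2 (\<lambda>n. P n z)" "l2 (\<lambda>n. Q n z)"
proof -
  obtain \<nu>1 \<nu>2 where \<nu>: "has_moments \<nu>1 s" "has_moments \<nu>2 s" "\<nu>1 \<noteq> \<nu>2"
    using assms unfolding indeterminate_def by blast
  then obtain z where z: "Im z \<noteq> 0" and ne: "stieltjes \<nu>1 z \<noteq> stieltjes \<nu>2 z"
    using stieltjes_unique has_moments_real_distribution s_0 by metis
  define w where "w = stieltjes \<nu>1 z - stieltjes \<nu>2 z"
  have w: "w \<noteq> 0" using ne by (simp add: w_def)
  let ?h = "\<lambda>\<nu> n. stieltjes \<nu> z * P n z + Q n z"
  have "l2 (\<lambda>n. 1 / w * (?h \<nu>1 n + (- 1) * ?h \<nu>2 n))"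
    by (intro l2_cmult l2_add bessel \<nu> z)
  moreover have "1 / w * (?h \<nu>1 n + (- 1) * ?h \<nu>2 n) = P n z" for n
    using w by (simp add: field_simps) (simp add: w_def algebra_simps)
  ultimately have P: "l2 (\<lambda>n. P n z)" by simp
  have "l2 (\<lambda>n. ?h \<nu>1 n + (- stieltjes \<nu>1 z) * P n z)"
    by (intro l2_cmult l2_add bessel \<nu> z P)
  then have "l2 (\<lambda>n. Q n z)" by simp
  with P show ?thesis by (rule that)
qed

text \<open>A lower bound for the Poisson kernel, of the form \<open>\<bar>Im z\<bar>\<close> over
  \<open>2 * (1 + (cmod z)\<^sup>2) * (1 + x\<^sup>2)\<close>, is integrated over \<open>x\<close>.
  The bound permits division by the transform when \<open>P\<close> is estimated by
  \<open>Q\<close>.\<close>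

lemma stieltjes_lower_bound:
  obtains c where "0 < c" "\<And>z. c * \<bar>Im z\<bar> \<le> (1 + (cmod z)\<^sup>2) * cmod (stieltjes \<mu> z)"
proof -
  interpret real_distribution \<mu> using moments s_0 by (rule has_moments_real_distribution)
  define c where "c = (\<integral>x. 1 / (2 * (1 + x\<^sup>2)) \<partial>\<mu>)"
  have int: "integrable \<mu> (\<lambda>x. 1 / (2 * (1 + x\<^sup>2)) :: real)"
    by (rule integrable_const_bound[of _ 1])
      (auto simp: measurable_cong_sets[OF events_eq_borel refl] divide_le_eq add_pos_nonneg)
  have pos: "0 < 1 / (2 * (1 + x\<^sup>2))" for x :: real by (simp add: add_pos_nonneg)
  have "0 < c" unfolding c_def by (rule expectation_greater[OF int]) (simp add: add_pos_nonneg)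
  moreover have "c * \<bar>Im z\<bar> \<le> (1 + (cmod z)\<^sup>2) * cmod (stieltjes \<mu> z)" for z
  proof (cases "Im z = 0")
    case False
    define y where "y = Im z"
    have y: "y \<noteq> 0" using False by (simp add: y_def)
    have z: "z = Complex (Re z) y" by (simp add: y_def)
    have "\<bar>y\<bar> * (1 / (2 * (1 + x\<^sup>2))) \<le> (1 + (cmod z)\<^sup>2) * (\<bar>y\<bar> / (y\<^sup>2 + (Re z - x)\<^sup>2))" for x
    proof -
      have "y\<^sup>2 + (Re z - x)\<^sup>2 \<le> 2 * ((cmod z)\<^sup>2 + x\<^sup>2)"
      proof -
        have "2 * ((cmod z)\<^sup>2 + x\<^sup>2) = (y\<^sup>2 + (Re z - x)\<^sup>2) + (y\<^sup>2 + (Re z + x)\<^sup>2)"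
          unfolding cmod_power2 y_def[symmetric] by (simp add: power2_eq_square algebra_simps)
        then show ?thesis by simp
      qed
      also have "\<dots> \<le> (1 + (cmod z)\<^sup>2) * (2 * (1 + x\<^sup>2))"
        by (simp add: algebra_simps)
      finally have "y\<^sup>2 + (Re z - x)\<^sup>2 \<le> (1 + (cmod z)\<^sup>2) * (2 * (1 + x\<^sup>2))" .
      moreover have "0 < y\<^sup>2 + (Re z - x)\<^sup>2" using y by (simp add: add_pos_nonneg)
      ultimately have "1 / (2 * (1 + x\<^sup>2)) \<le> (1 + (cmod z)\<^sup>2) / (y\<^sup>2 + (Re z - x)\<^sup>2)"
        using pos[of x] by (simp add: field_simps add_pos_nonneg)
      then have "\<bar>y\<bar> * (1 / (2 * (1 + x\<^sup>2))) \<le> \<bar>y\<bar> * ((1 + (cmod z)\<^sup>2) / (y\<^sup>2 + (Re z - x)\<^sup>2))"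
        by (rule mult_left_mono) simp
      then show ?thesis by (simp add: mult_ac)
    qed
    moreover have i: "integrable \<mu> (\<lambda>x. \<bar>y\<bar> / (y\<^sup>2 + (Re z - x)\<^sup>2))"
      using integrable_abs[OF Im_stieltjes(1)[OF y, of "Re z"]] by (simp add: abs_divide)
    ultimately have "(\<integral>x. \<bar>y\<bar> * (1 / (2 * (1 + x\<^sup>2))) \<partial>\<mu>)
        \<le> (\<integral>x. (1 + (cmod z)\<^sup>2) * (\<bar>y\<bar> / (y\<^sup>2 + (Re z - x)\<^sup>2)) \<partial>\<mu>)"
      by (intro integral_mono integrable_mult_right int)
    then have "\<bar>y\<bar> * c \<le> (1 + (cmod z)\<^sup>2) * (\<integral>x. \<bar>y\<bar> / (y\<^sup>2 + (Re z - x)\<^sup>2) \<partial>\<mu>)"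
      unfolding c_def by (simp only: integral_mult_right_zero)
    also have "(\<integral>x. \<bar>y\<bar> / (y\<^sup>2 + (Re z - x)\<^sup>2) \<partial>\<mu>) = (\<integral>x. sgn y * (y / (y\<^sup>2 + (Re z - x)\<^sup>2)) \<partial>\<mu>)"
      by (simp add: abs_sgn mult.commute)
    also have "\<dots> = sgn y * Im (stieltjes \<mu> z)"
      unfolding Im_stieltjes(2)[OF y, of "Re z", folded z] by (simp only: integral_mult_right_zero)
    also have "(1 + (cmod z)\<^sup>2) * (sgn y * Im (stieltjes \<mu> z)) \<le> (1 + (cmod z)\<^sup>2) * cmod (stieltjes \<mu> z)"
    proof (rule mult_left_mono)
      have "sgn y * Im (stieltjes \<mu> z) \<le> \<bar>sgn y * Im (stieltjes \<mu> z)\<bar>" by simp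
      also have "\<dots> = \<bar>Im (stieltjes \<mu> z)\<bar>" using y by (simp add: abs_mult abs_sgn_eq)
      finally show "sgn y * Im (stieltjes \<mu> z) \<le> cmod (stieltjes \<mu> z)"
        using abs_Im_le_cmod[of "stieltjes \<mu> z"] by linarith
    qed simp
    finally show ?thesis by (simp add: y_def mult.commute)
  qed simp
  ultimately show ?thesis by (rule that)
qed

end

subsection \<open>Indeterminate problems\<close>

lemma Cauchy_coeff_bound:
  fixes r :: "complex poly"
  assumes "0 < R" and "\<And>z. cmod z = R \<Longrightarrow> cmod (poly r z) \<le> B"
  shows "cmod (coeff r k) * R ^ k \<le> B"
proof -
  have deriv: "(deriv ^^ k) (poly q) = poly ((pderiv ^^ k) q)" for q :: "complex poly"
  proof (induction k)
    case (Suc k)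
    have "deriv (poly ((pderiv ^^ k) q)) = poly (pderiv ((pderiv ^^ k) q))"
      by (rule ext) (rule DERIV_imp_deriv[OF poly_DERIV])
    with Suc show ?case by simp
  qed simp
  have coeff: "poly ((pderiv ^^ k) q) 0 = fact k * coeff q k" for q :: "complex poly"
  proof (induction k arbitrary: q)
    case (Suc k)
    have "poly ((pderiv ^^ Suc k) q) 0 = poly ((pderiv ^^ k) (pderiv q)) 0"
      by (simp add: funpow_swap1)
    also have "\<dots> = fact (Suc k) * coeff q (Suc k)"
      by (simp add: Suc coeff_pderiv mult_ac)
    finally show ?case .
  qed (simp add: poly_0_coeff_0)
  have "cmod ((deriv ^^ k) (poly r) 0) \<le> fact k * B / R ^ k"
    by (rule Cauchy_inequality) (use assms in \<open>auto intro!: holomorphic_intros continuous_intros\<close>)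
  then have "fact k * cmod (coeff r k) \<le> fact k * (B / R ^ k)"
    by (simp add: deriv coeff norm_mult)
  then have "cmod (coeff r k) \<le> B / R ^ k" by (rule mult_left_le_imp_le) simp
  then show ?thesis using assms(1) by (simp add: field_simps)
qed

locale indeterminate_problem = hamburger_problem +
  assumes indeterminate: "indeterminate s"
begin

lemma solution_family_P: "solution_family P Q P"
  by unfold_locales (rule P_recurrence cnj_P cnj_Q)+

lemma solution_family_Q: "solution_family P Q Q"
  by unfold_locales (rule Q_recurrence cnj_P cnj_Q)+

lemma l2_PQ: "l2 (\<lambda>n. P n z)" "l2 (\<lambda>n. Q n z)"
proof -
  obtain w where w: "l2 (\<lambda>n. P n w)" "l2 (\<lambda>n. Q n w)"
    using l2_of_indeterminate[OF indeterminate] by blast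
  show "l2 (\<lambda>n. P n z)"
    using solution_family.gronwall[OF solution_family_P w w(1)] by metis
  show "l2 (\<lambda>n. Q n z)"
    using solution_family.gronwall[OF solution_family_Q w w(2)] by metis
qed

lemma P_0_nonzero: "P 0 0 \<noteq> 0"
  using L_1_eq by auto

text \<open>The starting values solve \<open>P n 0 = Q n 0 * x0 - P n 0 * y0\<close>; for
  \<open>Q\<close> in place of \<open>P\<close> on the left they are 1 and 0.\<close>

sublocale PN: nevanlinna_pair P Q P 0 "- 1"
proof (intro nevanlinna_pair.intro nevanlinna_pair_axioms.intro solution_family_P)
  show "\<exists>n. P n 0 \<noteq> 0" using P_0_nonzero by blast
qed (simp_all add: l2_PQ)

sublocale QN: nevanlinna_pair P Q Q 1 0
proof (intro nevanlinna_pair.intro nevanlinna_pair_axioms.intro solution_family_Q)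
  show "\<exists>n. Q n 0 \<noteq> 0" using Q_1_nonzero by blast
qed (simp_all add: l2_PQ)

section \<open>Equivalence of the six moment functions\<close>

lemma fun_P_eq: "fun_P p = PN.N"
  by (simp add: fun_eq_iff fun_P_def PN.N_def l2norm_def first_kind_eq)

lemma fun_Q_eq: "fun_Q \<mu> p = QN.N"
  by (simp add: fun_eq_iff fun_Q_def QN.N_def l2norm_def second_kind_eq)

lemma fun_D_eq: "fun_D p = PN.X"
  by (simp add: fun_eq_iff fun_D_def PN.X_def first_kind_eq)

lemma fun_B_eq: "fun_B \<mu> p = PN.Y"
  by (simp add: fun_eq_iff fun_B_def PN.Y_def first_kind_eq second_kind_eq)

lemma fun_C_eq: "fun_C \<mu> p = QN.X"
  by (simp add: fun_eq_iff fun_C_def QN.X_def first_kind_eq second_kind_eq)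

lemma fun_A_eq: "fun_A \<mu> p = QN.Y"
  by (simp add: fun_eq_iff fun_A_def QN.Y_def second_kind_eq)

lemma Q_dominated_by_P: "growth_dominated QN.N PN.N"
proof (rule growth_dominatedI[of _ _ 2 0])
  fix r :: real assume r: "0 \<le> r"
  let ?M = "max_modulus PN.N (r + 1)"
  show "max_modulus QN.N r \<le> 2 * (r + 1) ^ 0 * (?M + 1)"
  proof (rule max_modulus_le[OF r])
    fix z assume z: "cmod z \<le> r"
    have "l2norm (\<lambda>n. Q n z) ^ 1 \<le> 2 ^ 1 * (?M + 1)"
    proof (rule l2norm_max_principle[of Q 1 "r + 1" z 1])
      fix u assume u: "cmod u = r + 1"
      have M: "l2norm (\<lambda>n. P n u) \<le> ?M"
        using max_modulus_ge[OF PN.locally_bounded_N, of u "r + 1"] u by simp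
      show "\<bar>Im u\<bar> ^ 1 * l2norm (\<lambda>n. Q n u) ^ 1 \<le> ?M + 1"
      proof (cases "Im u = 0")
        case True
        then show ?thesis using M l2norm_nonneg[OF l2_PQ(1), of u] by simp
      next
        case False
        interpret real_distribution \<mu> using moments s_0 by (rule has_moments_real_distribution)
        let ?w = "stieltjes \<mu> u"
        have "l2norm (\<lambda>n. Q n u) = l2norm (\<lambda>n. (?w * P n u + Q n u) + (- ?w) * P n u)"
          by simp
        also have "\<dots> \<le> l2norm (\<lambda>n. ?w * P n u + Q n u) + l2norm (\<lambda>n. (- ?w) * P n u)"
          by (rule l2_add) (intro bessel moments False l2_cmult l2_PQ)+
        also have "\<dots> \<le> 1 / \<bar>Im u\<bar> + 1 / \<bar>Im u\<bar> * ?M"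
          unfolding l2_cmult(2)[OF l2_PQ(1)] norm_minus_cancel
          by (intro add_mono bessel moments False mult_mono norm_stieltjes_le M l2norm_nonneg l2_PQ) auto
        finally show ?thesis using False by (simp add: field_simps)
      qed
    qed (use z r in \<open>auto intro: QN.holomorphic l2_PQ\<close>)
    then show "cmod (QN.N z) \<le> 2 * (r + 1) ^ 0 * (?M + 1)" by simp
  qed
qed (auto intro: max_modulus_nonneg PN.locally_bounded_N QN.locally_bounded_N)

text \<open>Division by the Stieltjes transform costs a second factor
  \<open>\<bar>Im u\<bar>\<close> besides the one from Bessel's inequality, so the maximum principle
  is applied with \<open>m = 2\<close>.\<close>

lemma P_dominated_by_Q: "growth_dominated PN.N QN.N"
proof -
  obtain c where c: "0 < c" "\<And>z. c * \<bar>Im z\<bar> \<le> (1 + (cmod z)\<^sup>2) * cmod (stieltjes \<mu> z)"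
    using stieltjes_lower_bound by blast
  show ?thesis
  proof (rule growth_dominatedI[of _ _ "32 / c" 3])
    fix r :: real assume r: "0 \<le> r"
    define R where "R = r + 1"
    have R: "1 \<le> R" using r by (simp add: R_def)
    let ?M = "max_modulus QN.N R"
    have M0: "0 \<le> ?M" using R by (intro max_modulus_nonneg QN.locally_bounded_N) auto
    \<comment> \<open>On the circle, \<open>2 * R\<^sup>2\<close> bounds
      \<open>1 + (cmod u)\<^sup>2\<close>, and \<open>R * (?M + 1)\<close> bounds
      \<open>1 + \<bar>Im u\<bar> * ?M\<close>.\<close>
    define K where "K = 2 * R\<^sup>2 / c * (R * (?M + 1))"
    show "max_modulus PN.N r \<le> 32 / c * (r + 1) ^ 3 * (max_modulus QN.N (r + 1) + 1)"
    proof (rule max_modulus_le[OF r])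
      fix z assume z: "cmod z \<le> r"
      have "l2norm (\<lambda>n. P n z) ^ 1 \<le> 2 ^ 2 * K"
      proof (rule l2norm_max_principle[of P 1 R z 2])
        fix u assume u: "cmod u = R"
        have M: "l2norm (\<lambda>n. Q n u) \<le> ?M"
          using max_modulus_ge[OF QN.locally_bounded_N, of u R] u by simp
        have K0: "0 \<le> K" using c R M0 by (simp add: K_def)
        show "\<bar>Im u\<bar> ^ 2 * l2norm (\<lambda>n. P n u) ^ 1 \<le> K"
        proof (cases "Im u = 0")
          case False
          let ?w = "stieltjes \<mu> u"
          have "1 + (cmod u)\<^sup>2 \<le> 2 * R\<^sup>2" using u R by simp
          then have "(1 + (cmod u)\<^sup>2) * cmod ?w \<le> 2 * R\<^sup>2 * cmod ?w"
            by (rule mult_right_mono) simp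
          with c(2)[of u] have w: "c * \<bar>Im u\<bar> \<le> 2 * R\<^sup>2 * cmod ?w" by linarith
          have "cmod ?w * l2norm (\<lambda>n. P n u) = l2norm (\<lambda>n. (?w * P n u + Q n u) + (- 1) * Q n u)"
            using l2_cmult(2)[OF l2_PQ(1), of ?w u] by simp
          also have "\<dots> \<le> l2norm (\<lambda>n. ?w * P n u + Q n u) + l2norm (\<lambda>n. (- 1) * Q n u)"
            by (rule l2_add) (intro bessel moments False l2_cmult l2_PQ)+
          also have "\<dots> \<le> 1 / \<bar>Im u\<bar> + ?M"
            unfolding l2_cmult(2)[OF l2_PQ(2)]
            using bessel(2)[OF moments False] M by simp
          finally have *: "cmod ?w * l2norm (\<lambda>n. P n u) \<le> 1 / \<bar>Im u\<bar> + ?M" .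
          have "c * \<bar>Im u\<bar> * (\<bar>Im u\<bar> * l2norm (\<lambda>n. P n u)) \<le> 2 * R\<^sup>2 * cmod ?w * (\<bar>Im u\<bar> * l2norm (\<lambda>n. P n u))"
            by (intro mult_right_mono w mult_nonneg_nonneg l2norm_nonneg l2_PQ) auto
          also have "\<dots> = 2 * R\<^sup>2 * \<bar>Im u\<bar> * (cmod ?w * l2norm (\<lambda>n. P n u))"
            by (simp add: mult_ac)
          also have "\<dots> \<le> 2 * R\<^sup>2 * \<bar>Im u\<bar> * (1 / \<bar>Im u\<bar> + ?M)"
            by (intro mult_left_mono *) auto
          also have "\<dots> = 2 * R\<^sup>2 * (1 + \<bar>Im u\<bar> * ?M)"
            using False by (simp add: distrib_left)
          also have "\<dots> \<le> 2 * R\<^sup>2 * (R * (?M + 1))"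
          proof (rule mult_left_mono)
            have "\<bar>Im u\<bar> * ?M \<le> R * ?M"
              using abs_Im_le_cmod[of u] u M0 by (intro mult_right_mono) auto
            then show "1 + \<bar>Im u\<bar> * ?M \<le> R * (?M + 1)" using R by (simp add: distrib_left)
          qed simp
          finally show ?thesis using c(1) by (simp add: K_def field_simps power2_eq_square)
        qed (use K0 in simp)
      qed (use z R in \<open>auto intro: PN.holomorphic l2_PQ simp: R_def\<close>)
      also have "2 ^ 2 * K = 8 / c * R ^ 3 * (?M + 1)"
        by (simp add: K_def power2_eq_square power3_eq_cube)
      also have "\<dots> \<le> 32 / c * R ^ 3 * (?M + 1)"
        using c(1) R M0 by (intro mult_right_mono divide_right_mono) auto
      finally show "cmod (PN.N z) \<le> 32 / c * (r + 1) ^ 3 * (max_modulus QN.N (r + 1) + 1)"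
        by (simp add: R_def)
    qed
  qed (use c in \<open>auto intro: max_modulus_nonneg PN.locally_bounded_N QN.locally_bounded_N\<close>)
qed

lemma moment_functions_equivalent:
  assumes "f \<in> moment_functions \<mu> p"
  shows "growth_dominated f PN.N" "growth_dominated PN.N f"
proof -
  have refl: "growth_dominated PN.N PN.N"
    using growth_dominated_trans PN.growth_dominated_XY by blast
  show "growth_dominated f PN.N" "growth_dominated PN.N f"
    using assms refl PN.growth_dominated_XY QN.growth_dominated_XY Q_dominated_by_P P_dominated_by_Q
    unfolding moment_functions_def fun_A_eq fun_B_eq fun_C_eq fun_D_eq fun_P_eq fun_Q_eq
    by (auto intro: growth_dominated_trans)
qed

text \<open>The definite description is met because all six functions are equivalent to
  \<open>PN.N\<close>, and is unique because \<open>fun_P p\<close> is one of them.\<close>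

lemma moment_order_eq: "moment_order \<mu> p = growth_order PN.N"
  unfolding moment_order_def
proof (rule the_equality)
  show "\<forall>f\<in>moment_functions \<mu> p. growth_order f = growth_order PN.N"
    using growth_equal(1) moment_functions_equivalent by blast
  show "\<rho> = growth_order PN.N" if "\<forall>f\<in>moment_functions \<mu> p. growth_order f = \<rho>" for \<rho>
    using that by (simp add: moment_functions_def fun_P_eq)
qed

lemma moment_type_eq:
  assumes "0 < growth_order PN.N" "growth_order PN.N < \<infinity>"
  shows "moment_type \<mu> p = growth_type PN.N"
  unfolding moment_type_def
proof (rule the_equality)
  show "\<forall>f\<in>moment_functions \<mu> p. growth_type f = growth_type PN.N"
    using growth_equal(2)[OF _ _ assms] moment_functions_equivalent by blast
  show "\<tau> = growth_type PN.N" if "\<forall>f\<in>moment_functions \<mu> p. growth_type f = \<tau>" for \<tau>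
    using that by (simp add: moment_functions_def fun_P_eq)
qed

section \<open>Comparison of the coefficient norms with the function P\<close>

lemma coeff_bound:
  assumes "0 < r"
  shows "L2_set (\<lambda>n. cmod (coeff (cp n) k)) {..<N} * r ^ k \<le> max_modulus PN.N r"
proof -
  let ?s = "L2_set (\<lambda>n. cmod (coeff (cp n) k)) {..<N}" and ?M = "max_modulus PN.N r"
  have M0: "0 \<le> ?M" using assms by (intro max_modulus_nonneg PN.locally_bounded_N) auto
  \<comment> \<open>The conjugated coefficients make coefficient \<open>k\<close> of
    \<open>q\<close> equal to \<open>?s\<^sup>2\<close>, while Cauchy-Schwarz bounds
    \<open>q\<close> on the circle by \<open>?s * ?M\<close>. Cauchy's estimate then needs only
    division by \<open>?s\<close>.\<close>
  define q where "q = (\<Sum>n<N. smult (cnj (coeff (cp n) k)) (cp n))"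
  have "cmod (coeff q k) * r ^ k \<le> ?s * ?M"
  proof (rule Cauchy_coeff_bound[OF assms])
    fix z assume z: "cmod z = r"
    have "cmod (poly q z) = cmod (\<Sum>n<N. cnj (coeff (cp n) k) * P n z)"
      by (simp add: q_def poly_sum P_def)
    also have "\<dots> \<le> L2_set (\<lambda>n. cmod (cnj (coeff (cp n) k))) {..<N} * L2_set (\<lambda>n. cmod (P n z)) {..<N}"
      by (rule norm_sum_mult_le_L2_set)
    also have "\<dots> \<le> ?s * l2norm (\<lambda>n. P n z)"
      by (auto intro!: mult_left_mono L2_set_le_l2norm l2_PQ)
    also have "\<dots> \<le> ?s * ?M"
      using max_modulus_ge[OF PN.locally_bounded_N, of z r] z by (intro mult_left_mono) auto
    finally show "cmod (poly q z) \<le> ?s * ?M" .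
  qed
  moreover have "cmod (coeff q k) = ?s\<^sup>2"
    unfolding q_def coeff_sum coeff_smult by (rule norm_sum_cnj_mult_self)
  ultimately have *: "?s * (?s * r ^ k) \<le> ?s * ?M" by (simp add: power2_eq_square mult_ac)
  show ?thesis
  proof (cases "?s = 0")
    case False
    then have "0 < ?s" using L2_set_nonneg[of "\<lambda>n. cmod (coeff (cp n) k)" "{..<N}"] by linarith
    with * show ?thesis by (rule mult_left_le_imp_le)
  qed (use M0 in simp)
qed

lemma l2_coeff: "l2 (\<lambda>n. coeff (cp n) k)"
  using coeff_bound[of 1 k] by (intro l2_of_L2_set_le(1)[of _ "max_modulus PN.N 1"]) simp

text \<open>The terms with \<open>n < k\<close> vanish for reasons of degree, so starting the sum at
  \<open>k\<close> loses nothing.\<close>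

lemma coeff_norm_eq: "coeff_norm p k = l2norm (\<lambda>n. coeff (cp n) k)"
proof -
  have eq: "(cmod (coeff (cp n) k))\<^sup>2 = (coeff (p n) k)\<^sup>2" for n
    by (simp add: cp_def coeff_map_poly)
  have sm: "summable (\<lambda>n. (coeff (p n) k)\<^sup>2)"
    using l2_coeff[of k] by (simp add: l2_def eq)
  have "(\<Sum>n<k. (coeff (p n) k)\<^sup>2) = 0"
    using orthonormal_polys by (auto simp: orthonormal_polys_def coeff_eq_0)
  then have "(\<Sum>n. (coeff (p (n + k)) k)\<^sup>2) = (\<Sum>n. (coeff (p n) k)\<^sup>2)"
    using suminf_minus_initial_segment[OF sm, of k] by simp
  then show ?thesis
    by (simp add: coeff_norm_def l2norm_def eq add.commute)
qed

lemma coeff_norm_nonneg: "0 \<le> coeff_norm p k"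
  unfolding coeff_norm_eq by (rule l2norm_nonneg[OF l2_coeff])

lemma coeff_norm_le:
  assumes "0 < r"
  shows "coeff_norm p k * r ^ k \<le> max_modulus PN.N r"
proof -
  have "L2_set (\<lambda>n. cmod (coeff (cp n) k)) {..<N} \<le> max_modulus PN.N r / r ^ k" for N
    using coeff_bound[OF assms, of k N] assms by (simp add: field_simps)
  from l2_of_L2_set_le(2)[OF this] show ?thesis
    using assms by (simp add: coeff_norm_eq field_simps)
qed

text \<open>The coefficient bound at radius \<open>r + 1\<close> gives a geometric majorant with
  ratio \<open>r / (r + 1)\<close>, whose series sums to \<open>r + 1\<close>.\<close>

lemma Phi_series:
  assumes "0 \<le> r"
  shows "summable (\<lambda>k. coeff_norm p k * r ^ k)"
    and "(\<Sum>k. coeff_norm p k * r ^ k) \<le> (r + 1) * max_modulus PN.N (r + 1)"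
proof -
  let ?M = "max_modulus PN.N (r + 1)" and ?q = "r / (r + 1)"
  have le: "coeff_norm p k * r ^ k \<le> ?M * ?q ^ k" for k
  proof -
    have "coeff_norm p k * r ^ k = coeff_norm p k * (r + 1) ^ k * ?q ^ k"
      using assms by (simp add: power_divide)
    also have "\<dots> \<le> ?M * ?q ^ k"
      using assms by (intro mult_right_mono coeff_norm_le) auto
    finally show ?thesis .
  qed
  have q: "norm ?q < 1" using assms by simp
  have "(\<lambda>k. ?M * ?q ^ k) sums (?M * (1 / (1 - ?q)))"
    by (intro sums_mult geometric_sums q)
  moreover have "?M * (1 / (1 - ?q)) = (r + 1) * ?M"
    using assms by (simp add: field_simps)
  ultimately have g: "(\<lambda>k. ?M * ?q ^ k) sums ((r + 1) * ?M)" by simp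
  show sm: "summable (\<lambda>k. coeff_norm p k * r ^ k)"
    by (rule summable_comparison_test'[OF sums_summable[OF g], of 0])
      (use le coeff_norm_nonneg assms in auto)
  show "(\<Sum>k. coeff_norm p k * r ^ k) \<le> (r + 1) * ?M"
    using suminf_le[OF le sm sums_summable[OF g]] sums_unique[OF g] by simp
qed

lemma norm_Phi_le:
  assumes "cmod z \<le> r"
  shows "cmod (Phi p z) \<le> (r + 1) * max_modulus PN.N (r + 1)"
proof -
  have r: "0 \<le> r" using assms norm_ge_zero[of z] by linarith
  have le: "norm (complex_of_real (coeff_norm p k) * z ^ k) \<le> coeff_norm p k * r ^ k" for k
    using coeff_norm_nonneg assms by (auto simp: norm_mult norm_power intro!: mult_left_mono power_mono)
  have sm: "summable (\<lambda>k. norm (complex_of_real (coeff_norm p k) * z ^ k))"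
    by (rule summable_comparison_test'[OF Phi_series(1)[OF r], of 0]) (use le in auto)
  have "cmod (Phi p z) \<le> (\<Sum>k. norm (complex_of_real (coeff_norm p k) * z ^ k))"
    unfolding Phi_def by (rule summable_norm[OF sm])
  also have "\<dots> \<le> (\<Sum>k. coeff_norm p k * r ^ k)"
    by (rule suminf_le[OF le sm Phi_series(1)[OF r]])
  finally show ?thesis using Phi_series(2)[OF r] by linarith
qed

lemma locally_bounded_Phi: "locally_bounded (Phi p)"
  unfolding locally_bounded_def using norm_Phi_le by blast

lemma Phi_dominated_by_P: "growth_dominated (Phi p) PN.N"
proof (rule growth_dominatedI[of _ _ 1 1])
  fix r :: real assume r: "0 \<le> r"
  have "max_modulus (Phi p) r \<le> (r + 1) * max_modulus PN.N (r + 1)"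
    using r by (intro max_modulus_le norm_Phi_le)
  then show "max_modulus (Phi p) r \<le> 1 * (r + 1) ^ 1 * (max_modulus PN.N (r + 1) + 1)"
    using r by (simp add: distrib_left)
qed (auto intro: max_modulus_nonneg PN.locally_bounded_N locally_bounded_Phi)

lemma P_dominated_by_Phi: "growth_dominated PN.N (Phi p)"
proof (rule growth_dominatedI[of _ _ 1 0])
  fix r :: real assume r: "0 \<le> r"
  have "max_modulus PN.N r \<le> max_modulus (Phi p) (r + 1)"
  proof (rule max_modulus_le[OF r])
    fix z assume z: "cmod z \<le> r"
    define t where "t = cmod z"
    have t: "0 \<le> t" by (simp add: t_def)
    have "L2_set (\<lambda>n. cmod (P n z)) {..<N} \<le> (\<Sum>k. coeff_norm p k * t ^ k)" for N
    proof -
      \<comment> \<open>Minkowski's inequality in the index \<open>n\<close>, one power of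
        \<open>z\<close> at a time. The number \<open>K\<close> of powers is independent of
        \<open>N\<close> for the sake of the induction.\<close>
      have 1: "L2_set (\<lambda>n. cmod (\<Sum>k<K. coeff (cp n) k * z ^ k)) {..<N} \<le> (\<Sum>k<K. coeff_norm p k * t ^ k)" for K
      proof (induction K)
        case (Suc K)
        have "L2_set (\<lambda>n. cmod (\<Sum>k<Suc K. coeff (cp n) k * z ^ k)) {..<N}
            \<le> L2_set (\<lambda>n. cmod (\<Sum>k<K. coeff (cp n) k * z ^ k) + cmod (coeff (cp n) K * z ^ K)) {..<N}"
          by (intro L2_set_mono) (auto intro: norm_triangle_ineq)
        also have "\<dots> \<le> L2_set (\<lambda>n. cmod (\<Sum>k<K. coeff (cp n) k * z ^ k)) {..<N}
            + L2_set (\<lambda>n. cmod (coeff (cp n) K * z ^ K)) {..<N}"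
          by (rule L2_set_triangle_ineq)
        also have "L2_set (\<lambda>n. cmod (coeff (cp n) K * z ^ K)) {..<N}
            = L2_set (\<lambda>n. cmod (coeff (cp n) K)) {..<N} * t ^ K"
          by (simp add: norm_mult norm_power t_def L2_set_left_distrib)
        also have "\<dots> \<le> coeff_norm p K * t ^ K"
          unfolding coeff_norm_eq using t by (intro mult_right_mono L2_set_le_l2norm l2_coeff) auto
        finally show ?case using Suc by simp
      qed (simp add: L2_set_def)
      \<comment> \<open>As \<open>cp n\<close> has degree \<open>n\<close>, a single truncation at
        \<open>N\<close> recovers every \<open>P n z\<close> with \<open>n < N\<close>.\<close>
      have "(\<Sum>k<N. coeff (cp n) k * z ^ k) = P n z" if "n < N" for n
        unfolding P_def poly_altdef degree_p
        by (rule sum.mono_neutral_right) (use that degree_p[of n] in \<open>auto intro!: coeff_eq_0\<close>)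
      then have "L2_set (\<lambda>n. cmod (P n z)) {..<N} = L2_set (\<lambda>n. cmod (\<Sum>k<N. coeff (cp n) k * z ^ k)) {..<N}"
        by (intro L2_set_cong) auto
      also have "\<dots> \<le> (\<Sum>k<N. coeff_norm p k * t ^ k)" by (rule 1)
      also have "\<dots> \<le> (\<Sum>k. coeff_norm p k * t ^ k)"
        by (rule sum_le_suminf[OF Phi_series(1)[OF t]]) (use t coeff_norm_nonneg in auto)
      finally show ?thesis .
    qed
    from l2_of_L2_set_le(2)[OF this] have "cmod (PN.N z) \<le> (\<Sum>k. coeff_norm p k * t ^ k)"
      by simp
    \<comment> \<open>The majorant is the value of the series at the point \<open>t\<close> of the
      nonnegative real axis.\<close>
    also have "(\<Sum>k. coeff_norm p k * t ^ k) \<le> cmod (Phi p (of_real t))"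
    proof -
      have "Phi p (of_real t) = of_real (\<Sum>k. coeff_norm p k * t ^ k)"
        unfolding Phi_def by (subst suminf_of_real[OF Phi_series(1)[OF t]]) simp
      then show ?thesis by simp
    qed
    also have "\<dots> \<le> max_modulus (Phi p) (r + 1)"
      using z by (intro max_modulus_ge locally_bounded_Phi) (simp add: t_def)
    finally show "cmod (PN.N z) \<le> max_modulus (Phi p) (r + 1)" .
  qed
  then show "max_modulus PN.N r \<le> 1 * (r + 1) ^ 0 * (max_modulus (Phi p) (r + 1) + 1)" by simp
qed (auto intro: max_modulus_nonneg PN.locally_bounded_N locally_bounded_Phi)

end

theorem theorem3p1:
  fixes \<mu> :: "real measure" and s :: "nat \<Rightarrow> real" and p :: "nat \<Rightarrow> real poly"
  assumes "prob_space \<mu>" and "infinite (measure_support \<mu>)"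
    and "has_moments \<mu> s" and "indeterminate s"
    and "orthonormal_polys \<mu> p"
  shows "growth_order (Phi p) = moment_order \<mu> p \<and>
         (0 < moment_order \<mu> p \<and> moment_order \<mu> p < \<infinity> \<longrightarrow>
            growth_type (Phi p) = moment_type \<mu> p)"
proof -
  interpret indeterminate_problem \<mu> s p
    by (intro indeterminate_problem.intro hamburger_problem.intro indeterminate_problem_axioms.intro assms)
  note eq = growth_equal[OF Phi_dominated_by_P P_dominated_by_Phi]
  show ?thesis
    using eq moment_type_eq by (auto simp: moment_order_eq)
qed

end
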